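(* In dimension $d=2$, the critical intensities of the Poisson secrecy graph satisfy \[ \lambda_{\mathbf U}\ge 0.002,\qquad \lambda_{\mathbf O}\ge 0.0008,\quad \lambda_{\mathbf I}\ge 0.0008,\quad \lambda_{\mathbf S}\ge 0.0008,\qquad \lambda_{\mathbf B}\ge 0.0005. \]
   Context: Let $\mathcal P$ (black points) and $\mathcal P'$ (red points) be independent Poisson processes in $\mathbb R^d$ of intensities $1$ and $\lambda>0$ respectively. The directed secrecy graph $\vec G_{\rm sec}$ has vertex set $\mathcal P$, with a directed edge from $x\in\mathcal P$ to $y\in\mathcal P$ ($x\ne y$) if there is no point of $\mathcal P'$ in the open ball $B(x,\|x-y\|)$ with center $x$ and radius $\|x-y\|$ (Euclidean norm). $G_{\rm sec}$ is the undirected graph obtained from $\vec G_{\rm sec}$ by forgetting orientations (and replacing double edges by single edges). $G'_{\rm sec}$ is the undirected graph on $\mathcal P$ containing exactly those edges $xy$ for which both $\vec{xy}$ and $\vec{yx}$ are edges of $\vec G_{\rm sec}$. An out-component (resp. in-component) of $\vec G_{\rm sec}$ is a subgraph having a spanning subtree whose edges are all directed away from (resp. towards) a root vertex. A subgraph is strongly connected if it contains directed paths from $x$ to $y$ for all of its vertices $x,y$. Define the events: $\mathbf U$: $G_{\rm sec}$ has an infinite component; $\mathbf O$: $\vec G_{\rm sec}$ has an infinite out-component; $\mathbf I$: $\vec G_{\rm sec}$ has an infinite in-component; $\mathbf S$: $\vec G_{\rm sec}$ has an infinite strongly connected subgraph; $\mathbf B$: $G'_{\rm sec}$ has an infinite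 component. For $\mathbf X\in\{\mathbf U,\mathbf O,\mathbf I,\mathbf S,\mathbf B\}$ let $p_{\mathbf X}(\lambda,d)=\mathbb P(\mathbf X)$; it takes only the values $0$ and $1$ and is non-increasing in $\lambda$. The critical intensity is \[ \lambda_{\mathbf X,d}=\inf\{\lambda:p_{\mathbf X}(\lambda,d)=0\}=\sup\{\lambda:p_{\mathbf X}(\lambda,d)=1\}, \] and $\lambda_{\mathbf X}=\lambda_{\mathbf X,2}$. *)

theory Defs
  imports "HOL-Probability.Probability" "Graph_Theory.Digraph_Component"
begin

text \<open>A point process is a random locally finite set; configurations carry the
  \<open>\<sigma>\<close>-algebra generated by the counts in bounded Borel sets.\<close>

definition locally_finite_sets :: "'a::euclidean_space set set" where
  "locally_finite_sets = {S. \<forall>A. bounded A \<longrightarrow> finite (S \<inter> A)}"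

definition configurations :: "'a::euclidean_space set measure" where
  "configurations = sigma locally_finite_sets
     {{S \<in> locally_finite_sets. card (S \<inter> A) = k} | A k. A \<in> sets borel \<and> bounded A}"

text \<open>The Poisson probabilities are written out, because \<^const>\<open>poisson_pmf\<close> is unspecified
  for rate 0, which occurs for null sets \<open>A\<close>.\<close>

definition poisson_process ::
    "'w measure \<Rightarrow> real \<Rightarrow> ('w \<Rightarrow> 'a::euclidean_space set) \<Rightarrow> bool" where
  "poisson_process M c N \<longleftrightarrow>
     prob_space M \<and> N \<in> measurable M configurations \<and>
     (\<forall>A k. A \<in> sets borel \<and> bounded A \<longrightarrow>
        measure M {\<omega> \<in> space M. card (N \<omega> \<inter> A) = k} =
          (c * measure lborel A) ^ k / fact k * exp (- (c * measure lborel A))) \<and>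
     (\<forall>(A :: nat \<Rightarrow> 'a set) n.
        (\<forall>i<n. A i \<in> sets borel \<and> bounded (A i)) \<and> disjoint_family_on A {..<n} \<longrightarrow>
        prob_space.indep_vars M (\<lambda>_. count_space UNIV) (\<lambda>i \<omega>. card (N \<omega> \<inter> A i)) {..<n})"

definition independent_poisson_processes ::
    "'w measure \<Rightarrow> real \<Rightarrow> ('w \<Rightarrow> 'a::euclidean_space set) \<Rightarrow> real \<Rightarrow> ('w \<Rightarrow> 'a set) \<Rightarrow> bool" where
  "independent_poisson_processes M c P c' P' \<longleftrightarrow>
     poisson_process M c P \<and> poisson_process M c' P' \<and>
     prob_space.indep_var M configurations P configurations P'"

text \<open>\<open>P\<close> is the set of black points, \<open>P'\<close> the set of red points. Undirected graphs are
  represented by symmetric digraphs.\<close>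

definition secrecy_digraph :: "'a::metric_space set \<Rightarrow> 'a set \<Rightarrow> 'a pair_pre_digraph" where
  "secrecy_digraph P P' = \<lparr> pverts = P,
     parcs = {(x, y). x \<in> P \<and> y \<in> P \<and> x \<noteq> y \<and> P' \<inter> ball x (dist x y) = {}} \<rparr>"

definition secrecy_graph :: "'a::metric_space set \<Rightarrow> 'a set \<Rightarrow> 'a pair_pre_digraph" where
  "secrecy_graph P P' = mk_symmetric (with_proj (secrecy_digraph P P'))"

definition bidirectional_secrecy_graph ::
    "'a::metric_space set \<Rightarrow> 'a set \<Rightarrow> 'a pair_pre_digraph" where
  "bidirectional_secrecy_graph P P' = \<lparr> pverts = P,
     parcs = {(x, y). (x, y) \<in> parcs (secrecy_digraph P P') \<and>
                      (y, x) \<in> parcs (secrecy_digraph P P')} \<rparr>"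

text \<open>For a symmetric digraph the strongly connected components are the connected components
  of the undirected graph it represents.\<close>

definition has_infinite_component :: "'a pair_pre_digraph \<Rightarrow> bool" where
  "has_infinite_component G \<longleftrightarrow> (\<exists>C \<in> pre_digraph.sccs (with_proj G). infinite (verts C))"

text \<open>The underlying undirected graph of \<open>T\<close>, a digraph without loops and parallel arcs,
  is a tree. The constant \<^const>\<open>tree\<close> only
  excludes directed cycles of \<open>T\<close>, so it cannot be used here. In \<^term>\<open>mk_symmetric T\<close> every
  edge, traversed back and forth, is a cycle of length 2; hence the bound on the length.\<close>

definition underlying_tree :: "('a, 'b) pre_digraph \<Rightarrow> bool" where
  "underlying_tree T \<longleftrightarrow> Digraph_Component.connected T \<and>
     \<not> (\<exists>p. pre_digraph.cycle (with_proj (mk_symmetric T)) p \<and> 3 \<le> length p)"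

text \<open>An edge of a tree is directed away from (towards) the root \<open>r\<close> if the path in the tree
  from \<open>r\<close> to its head (from its tail to \<open>r\<close>) ends (starts) with this edge.\<close>

definition out_tree :: "'a \<Rightarrow> ('a, 'b) pre_digraph \<Rightarrow> bool" where
  "out_tree r T \<longleftrightarrow> underlying_tree T \<and> r \<in> verts T \<and>
     (\<forall>e \<in> arcs T. \<exists>p. pre_digraph.apath (with_proj (mk_symmetric T))
        r (p @ [(tail T e, head T e)]) (head T e))"

definition in_tree :: "'a \<Rightarrow> ('a, 'b) pre_digraph \<Rightarrow> bool" where
  "in_tree r T \<longleftrightarrow> underlying_tree T \<and> r \<in> verts T \<and>
     (\<forall>e \<in> arcs T. \<exists>p. pre_digraph.apath (with_proj (mk_symmetric T))
        (tail T e) ((tail T e, head T e) # p) r)"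

definition out_component :: "('a, 'b) pre_digraph \<Rightarrow> ('a, 'b) pre_digraph \<Rightarrow> bool" where
  "out_component H G \<longleftrightarrow> subgraph H G \<and> (\<exists>T r. spanning T H \<and> out_tree r T)"

definition in_component :: "('a, 'b) pre_digraph \<Rightarrow> ('a, 'b) pre_digraph \<Rightarrow> bool" where
  "in_component H G \<longleftrightarrow> subgraph H G \<and> (\<exists>T r. spanning T H \<and> in_tree r T)"

definition event_U :: "'a::metric_space set \<Rightarrow> 'a set \<Rightarrow> bool" where
  "event_U P P' \<longleftrightarrow> has_infinite_component (secrecy_graph P P')"

definition event_O :: "'a::metric_space set \<Rightarrow> 'a set \<Rightarrow> bool" where
  "event_O P P' \<longleftrightarrow>
     (\<exists>H. out_component H (with_proj (secrecy_digraph P P')) \<and> infinite (verts H))"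

definition event_I :: "'a::metric_space set \<Rightarrow> 'a set \<Rightarrow> bool" where
  "event_I P P' \<longleftrightarrow>
     (\<exists>H. in_component H (with_proj (secrecy_digraph P P')) \<and> infinite (verts H))"

definition event_S :: "'a::metric_space set \<Rightarrow> 'a set \<Rightarrow> bool" where
  "event_S P P' \<longleftrightarrow>
     (\<exists>H. subgraph H (with_proj (secrecy_digraph P P')) \<and> strongly_connected H \<and>
          infinite (verts H))"

definition event_B :: "'a::metric_space set \<Rightarrow> 'a set \<Rightarrow> bool" where
  "event_B P P' \<longleftrightarrow> has_infinite_component (bidirectional_secrecy_graph P P')"

text \<open>For every \<open>\<lambda>\<close>, the processes with parameter \<open>\<lambda>\<close> are realised as \<open>P \<lambda>\<close> and \<open>P' \<lambda>\<close> on
  the probability space \<open>M \<lambda>\<close>. The infimum is taken in the extended reals, where it is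
  \<open>\<infinity>\<close> for the empty set.\<close>

definition percolation_probability ::
    "(real \<Rightarrow> 'w measure) \<Rightarrow> (real \<Rightarrow> 'w \<Rightarrow> 'a set) \<Rightarrow> (real \<Rightarrow> 'w \<Rightarrow> 'a set) \<Rightarrow>
     ('a set \<Rightarrow> 'a set \<Rightarrow> bool) \<Rightarrow> real \<Rightarrow> real" where
  "percolation_probability M P P' X l =
     measure (M l) {\<omega> \<in> space (M l). X (P l \<omega>) (P' l \<omega>)}"

definition critical_intensity ::
    "(real \<Rightarrow> 'w measure) \<Rightarrow> (real \<Rightarrow> 'w \<Rightarrow> 'a set) \<Rightarrow> (real \<Rightarrow> 'w \<Rightarrow> 'a set) \<Rightarrow>
     ('a set \<Rightarrow> 'a set \<Rightarrow> bool) \<Rightarrow> ereal" where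
  "critical_intensity M P P' X =
     Inf {ereal l | l. 0 < l \<and> percolation_probability M P P' X l = 0}"

end

theory Submission
  imports Defs
begin

text \<open>
All five lower bounds follow from one fact: for \<open>0 < \<lambda> < 0.002\<close> the event \<open>B\<close> has positive
probability. An infinite component of the bidirectional graph is contained in an infinite
component of the undirected graph, and all its vertices lie in one strongly connected subgraph,
which in turn contains an infinite out-tree and an infinite in-tree. So \<open>B\<close> forces the other four
events, and none of the five probabilities vanishes below \<open>0.002\<close>.

Percolation comes from a Peierls argument on the square grid of mesh \<open>3/2\<close>. A cell is good if it
contains a black point and no red point lies in a cell that can meet an open ball of squared radius
\<open>18\<close> about one of its points. Points of two good cells that touch, even diagonally, are less than
\<open>\<surd>18\<close> apart and hence joined in both directions (\<open>mutual_edge\<close>). If the cluster of good cells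
reached from a long segment of the first axis is finite, it is surrounded by a circuit of bad cells
with consecutive cells sharing a side (\<open>finite_cluster_boundary\<close>), because a cochain of the square
lattice modulo 2 that is closed on every unit square is exact.

Every bad cell is explained by a seed: the cell itself being void of black points, which has
probability \<open>exp (- 9/4)\<close>, or a nearby cell containing a red point, which has probability at most
\<open>9/4 * \<lambda>\<close>. Different seeds are independent. The seeds along a blocking circuit form a connected
set, so they contain a long chain. Counting all chains of seeds is too wasteful at \<open>\<lambda> = 0.002\<close>,
because two red cells can act together whenever their difference is one of 200 vectors. A shortest
chain, however, has no shortcuts: the seed after next is never within reach of the current one, and
about \<open>58\<close> percent of the pairs of red steps disappear. The weighted number of chordless double
steps is a finite count, and it contracts by the factor \<open>0.82\<close> (\<open>two_step_bound\<close>). Therefore long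
chains are exponentially unlikely (\<open>chain_exists_prob_le\<close>), and with positive probability no circuit
surrounds the segment (\<open>mutual_cluster_positive\<close>).

It remains to see that the five events are measurable, since the probability of an event is read off
as a measure. For this each event is expressed by reachability in the secrecy digraph. The directed
components need the equivalence of infinite out-trees with infinite sets of reachable vertices
(\<open>infinite_out_component_iff\<close>). Every point of a locally finite set is the only one in some dyadic
cell, so that points are named by countably many cells with measurable positions, and reachability
becomes a countable combination of measurable conditions (\<open>measurable_relation_rtrancl\<close>).
\<close>

section \<open>Blocking circuits in the square lattice\<close>

definition side_adjacent :: "int \<times> int \<Rightarrow> int \<times> int \<Rightarrow> bool" where
  "side_adjacent c d \<longleftrightarrow> \<bar>fst c - fst d\<bar> + \<bar>snd c - snd d\<bar> = 1"

definition king_adjacent :: "int \<times> int \<Rightarrow> int \<times> int \<Rightarrow> bool" where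
  "king_adjacent c d \<longleftrightarrow> c \<noteq> d \<and> \<bar>fst c - fst d\<bar> \<le> 1 \<and> \<bar>snd c - snd d\<bar> \<le> 1"

text \<open>A function on \<open>\<int>\<close> with values in the integers modulo 2 (truth values, with \<open>\<noteq>\<close> as
addition) has a primitive: the parity of the number of its jumps between \<open>0\<close> and \<open>i\<close>.\<close>

lemma exists_primitive_int:
  fixes f :: "int \<Rightarrow> bool"
  shows "\<exists>g :: int \<Rightarrow> bool. \<forall>i. (g (i + 1) \<noteq> g i) = f i"
proof -
  define S where "S i = {k. f k \<and> (0 \<le> k \<and> k < i \<or> i \<le> k \<and> k < 0)}" for i
  have fin: "finite (S i)" for i
    by (rule finite_subset[of _ "{-\<bar>i\<bar>..\<bar>i\<bar>}"]) (auto simp: S_def)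
  have "(odd (card (S (i + 1))) \<noteq> odd (card (S i))) = f i" for i
  proof (cases "f i")
    case False
    have "k \<in> S (i + 1) \<longleftrightarrow> k \<in> S i" for k
      using False by (cases "k = i") (simp_all add: S_def, linarith)
    then have "S (i + 1) = S i" by blast
    with False show ?thesis by simp
  next
    case True
    show ?thesis
    proof (cases "i \<ge> 0")
      case True
      have "k \<in> S (i + 1) \<longleftrightarrow> k = i \<or> k \<in> S i" for k
        using True \<open>f i\<close> by (cases "k = i") (simp_all add: S_def, linarith)
      then have "S (i + 1) = insert i (S i)" by blast
      moreover have "i \<notin> S i" using True by (simp add: S_def)
      ultimately show ?thesis using fin \<open>f i\<close> by simp
    next
      case False
      have "k \<in> S i \<longleftrightarrow> k = i \<or> k \<in> S (i + 1)" for k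
        using False \<open>f i\<close> by (cases "k = i") (simp_all add: S_def, linarith)
      then have "S i = insert i (S (i + 1))" by blast
      moreover have "i \<notin> S (i + 1)" using False by (simp add: S_def)
      ultimately show ?thesis using fin \<open>f i\<close> by simp
    qed
  qed
  then show ?thesis by (intro exI[of _ "\<lambda>i. odd (card (S i))"] allI)
qed

text \<open>The first cohomology of the plane vanishes modulo 2. Here \<open>h\<close> and \<open>v\<close> are the values of
a cochain on horizontal and vertical edges; its potential is obtained by summing along the
first axis and then vertically, and closedness on unit squares carries the horizontal
condition from row to row.\<close>

lemma closed_cochain_exact:
  fixes h v :: "int \<Rightarrow> int \<Rightarrow> bool"
  assumes closed: "\<And>i j. (h i j \<noteq> h i (j + 1)) = (v i j \<noteq> v (i + 1) j)"
  shows "\<exists>g :: int \<times> int \<Rightarrow> bool. \<forall>i j. (g (i + 1, j) \<noteq> g (i, j)) = h i j \<and> (g (i, j + 1) \<noteq> g (i, j)) = v i j"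
proof -
  from exists_primitive_int[of "\<lambda>i. h i 0"]
  obtain g0 :: "int \<Rightarrow> bool" where g0: "\<forall>i. (g0 (i + 1) \<noteq> g0 i) = h i 0" ..
  have "\<forall>i. \<exists>g :: int \<Rightarrow> bool. \<forall>j. (g (j + 1) \<noteq> g j) = v i j"
    by (intro allI exists_primitive_int)
  from choice[OF this]
  obtain G :: "int \<Rightarrow> int \<Rightarrow> bool" where G: "\<forall>i j. (G i (j + 1) \<noteq> G i j) = v i j" ..
  define g where "g = (\<lambda>(i, j). g0 i \<noteq> (G i j \<noteq> G i 0))"
  have vert: "(g (i, j + 1) \<noteq> g (i, j)) = v i j" for i j
    using G[rule_format, of i j] unfolding g_def prod.case by (cases "G i 0"; cases "g0 i") simp_all
  have step: "((g (i + 1, j + 1) \<noteq> g (i, j + 1)) = h i (j + 1)) = ((g (i + 1, j) \<noteq> g (i, j)) = h i j)"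
    for i j
    using closed[of i j] vert[of i j] vert[of "i + 1" j]
    by (cases "g (i + 1, j + 1)"; cases "g (i, j + 1)"; cases "g (i + 1, j)"; cases "g (i, j)") simp_all
  have "(g (i + 1, j) \<noteq> g (i, j)) = h i j" for i j
  proof (induction j rule: int_induct[where k = 0])
    case base
    show ?case using g0[rule_format, of i] by (simp add: g_def)
  next
    case (step1 j)
    then show ?case using step[of i j] by blast
  next
    case (step2 j)
    then show ?case using step[of i "j - 1"] by simp
  qed
  with vert show ?thesis by (intro exI[of _ g] allI conjI)
qed

lemma side_adjacent_commute: "side_adjacent a b \<longleftrightarrow> side_adjacent b a"
  by (simp add: side_adjacent_def abs_minus_commute)

lemma side_adjacent_cases:
  assumes "side_adjacent a b"
  obtains (right) i j where "a = (i, j)" "b = (i + 1, j)" | (left) i j where "a = (i + 1, j)" "b = (i, j)"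
    | (up) i j where "a = (i, j)" "b = (i, j + 1)" | (down) i j where "a = (i, j + 1)" "b = (i, j)"
proof -
  obtain i j k l where [simp]: "a = (i, j)" "b = (k, l)" by (cases a, cases b)
  have "k = i + 1 \<and> l = j \<or> i = k + 1 \<and> l = j \<or> k = i \<and> l = j + 1 \<or> k = i \<and> j = l + 1"
    using assms unfolding side_adjacent_def by auto
  then consider "k = i + 1" "l = j" | "i = k + 1" "l = j" | "k = i" "l = j + 1" | "k = i" "j = l + 1"
    by blast
  then show ?thesis
  proof cases
    case 1 then show ?thesis by (intro right) simp_all
  next
    case 2 then show ?thesis by (intro left) simp_all
  next
    case 3 then show ?thesis by (intro up) simp_all
  next
    case 4 then show ?thesis by (intro down) simp_all
  qed
qed

lemma line_path:
  assumes "\<And>t. t \<in> {0..n} \<Longrightarrow> p t \<in> S" and "\<And>t. t \<in> {0..<n} \<Longrightarrow> side_adjacent (p t) (p (t + 1))"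
    and "(0::int) \<le> n"
  shows "(p 0, p n) \<in> {(a, b). a \<in> S \<and> b \<in> S \<and> side_adjacent a b}\<^sup>*"
  using assms(3,1,2)
proof (induction n rule: int_ge_induct)
  case (step i)
  then have "(p 0, p i) \<in> {(a, b). a \<in> S \<and> b \<in> S \<and> side_adjacent a b}\<^sup>*"
    "p i \<in> S" "p (i + 1) \<in> S" "side_adjacent (p i) (p (i + 1))" by auto
  then show ?case by (auto intro: rtrancl_into_rtrancl)
qed auto

text \<open>The outer boundary of a finite set \<open>C\<close> of cells that is connected by king moves is
connected by side steps. Only the consequence used later is stated: the boundary joins a
cell of the first axis beyond \<open>N\<close> to the left half plane, so that it is at least as wide as
the segment up to \<open>N\<close>.

Let \<open>D\<close> be the unbounded component of the complement. Take the edges between \<open>D\<close> and its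
complement whose end in \<open>D\<close> belongs to the component \<open>V\<close> of \<open>W\<close> containing \<open>(m, 0)\<close>, where
\<open>m\<close> is the first place beyond \<open>N\<close> at which the axis is in \<open>D\<close>. Each unit square has an even
number of them, so they form the coboundary of some \<open>g\<close>. As \<open>g\<close> is constant on \<open>D\<close> and on
\<open>C\<close>, either all edges between \<open>D\<close> and \<open>C\<close> are of this kind or none is.\<close>

lemma finite_cluster_boundary:
  fixes C :: "(int \<times> int) set"
  defines "W \<equiv> {w. w \<notin> C \<and> (\<exists>c\<in>C. king_adjacent c w)}"
  assumes fin: "finite C" and N: "0 \<le> N" and axis: "\<And>k. 0 \<le> k \<Longrightarrow> k \<le> N \<Longrightarrow> (k, 0) \<in> C"
    and conn: "\<And>c. c \<in> C \<Longrightarrow> ((0, 0), c) \<in> {(a, b). a \<in> C \<and> b \<in> C \<and> king_adjacent a b}\<^sup>*"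
  shows "\<exists>m w. N < m \<and> (m, 0) \<in> W \<and> fst w < 0 \<and>
    ((m, 0), w) \<in> {(a, b). a \<in> W \<and> b \<in> W \<and> side_adjacent a b}\<^sup>*"
proof -
  define R where "R = {(a, b). a \<in> - C \<and> b \<in> - C \<and> side_adjacent a b}"
  define S where "S = {(a, b). a \<in> W \<and> b \<in> W \<and> side_adjacent a b}"
  have symR: "sym (R\<^sup>*)" by (rule sym_rtrancl) (auto simp: sym_def R_def side_adjacent_def)
  obtain B where B: "\<And>i j. (i, j) \<in> C \<Longrightarrow> \<bar>i\<bar> < B \<and> \<bar>j\<bar> < B"
  proof
    fix i j assume "(i, j) \<in> C"
    then have "\<bar>i\<bar> + \<bar>j\<bar> \<le> (\<Sum>(i, j)\<in>C. \<bar>i\<bar> + \<bar>j\<bar>)"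
      using member_le_sum[of "(i, j)" C "\<lambda>(i, j). \<bar>i\<bar> + \<bar>j\<bar>"] fin by auto
    then show "\<bar>i\<bar> < (\<Sum>(i, j)\<in>C. \<bar>i\<bar> + \<bar>j\<bar>) + 1 \<and> \<bar>j\<bar> < (\<Sum>(i, j)\<in>C. \<bar>i\<bar> + \<bar>j\<bar>) + 1"
      by linarith
  qed
  have "(N, 0) \<in> C" using axis N by simp
  with B N have BN: "N < B" by fastforce
  define D where "D = {v. ((B, 0), v) \<in> R\<^sup>*}"
  have "(B, 0) \<notin> C" using B by fastforce
  then have DC: "v \<notin> C" if "v \<in> D" for v
    using that unfolding D_def by (auto elim!: rtranclE simp: R_def)
  have D_step: "b \<in> D" if "a \<in> D" "side_adjacent a b" "b \<notin> C" for a b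
    using that DC[of a] unfolding D_def by (auto simp: R_def intro: rtrancl_into_rtrancl)
  \<comment> \<open>The upper half of the square of radius \<open>B\<close> leads from the far right to the far left outside \<open>C\<close>.\<close>
  have far_left: "(- B, 0) \<in> D"
  proof -
    have out: "(i, j) \<in> - C" if "\<bar>i\<bar> = B \<or> \<bar>j\<bar> = B" for i j using B that by fastforce
    have "((B, 0), (B, B)) \<in> R\<^sup>*"
      using line_path[of B "\<lambda>t. (B, t)" "- C"] out BN N
      unfolding R_def by (auto simp: side_adjacent_def)
    moreover have "((B, B), (-B, B)) \<in> R\<^sup>*"
      using line_path[of "2 * B" "\<lambda>t. (B - t, B)" "- C"] out BN N
      unfolding R_def by (auto simp: side_adjacent_def)
    moreover have "((-B, B), (-B, 0)) \<in> R\<^sup>*"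
      using line_path[of B "\<lambda>t. (- B, B - t)" "- C"] out BN N
      unfolding R_def by (auto simp: side_adjacent_def)
    ultimately show ?thesis unfolding D_def by (metis mem_Collect_eq rtrancl_trans)
  qed
  have cross: "a \<in> C \<and> b \<in> W" if "a \<notin> D" "b \<in> D" "side_adjacent a b" for a b
  proof -
    have "a \<in> C" using D_step[of b a] that side_adjacent_commute by blast
    moreover have "king_adjacent a b" using that by (auto simp: side_adjacent_def king_adjacent_def)
    ultimately show ?thesis using DC that by (auto simp: W_def)
  qed
  have W_near: "b \<in> W" if "a \<in> C" "b \<in> D" "king_adjacent a b" for a b
    using that DC by (auto simp: W_def)
  obtain m where m: "N < m" "(m, 0) \<in> D" "(m - 1, 0) \<notin> D"
  proof -
    let ?M = "{k \<in> {N<..B}. (k, 0) \<in> D}"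
    have "finite ?M" by (rule finite_subset[of _ "{N<..B}"]) auto
    moreover have "B \<in> ?M" using BN by (auto simp: D_def)
    ultimately have 1: "Min ?M \<in> ?M" "\<And>k. k \<in> ?M \<Longrightarrow> Min ?M \<le> k"
      using Min_in[of ?M] Min_le[of ?M] by blast+
    have "(Min ?M - 1, 0) \<notin> D"
    proof
      assume *: "(Min ?M - 1, 0) \<in> D"
      have "Min ?M - 1 \<noteq> N" using DC[OF *] axis[of N] N by auto
      with * 1(1) have "Min ?M - 1 \<in> ?M" by auto
      from 1(2)[OF this] show False by simp
    qed
    with 1(1) that[of "Min ?M"] show ?thesis by simp
  qed
  obtain k where k: "0 < k" "(- k, 0) \<in> D" "(1 - k, 0) \<notin> D"
  proof -
    let ?M = "{k \<in> {0<..B}. (- k, 0) \<in> D}"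
    have "finite ?M" by (rule finite_subset[of _ "{0<..B}"]) auto
    moreover have "B \<in> ?M" using BN N far_left by auto
    ultimately have 1: "Min ?M \<in> ?M" "\<And>k. k \<in> ?M \<Longrightarrow> Min ?M \<le> k"
      using Min_in[of ?M] Min_le[of ?M] by blast+
    have "(1 - Min ?M, 0) \<notin> D"
    proof
      assume *: "(1 - Min ?M, 0) \<in> D"
      have "Min ?M \<noteq> 1" using DC[OF *] axis[of 0] N by auto
      with * 1(1) have "Min ?M - 1 \<in> ?M" by auto
      from 1(2)[OF this] show False by simp
    qed
    with 1(1) that[of "Min ?M"] show ?thesis by simp
  qed
  define V where "V = {w. ((m, 0), w) \<in> S\<^sup>*}"
  have mW: "(m - 1, 0) \<in> C" "(m, 0) \<in> W"
    using cross[of "(m - 1, 0)" "(m, 0)"] m by (auto simp: side_adjacent_def)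
  have kW: "(1 - k, 0) \<in> C" "(- k, 0) \<in> W"
    using cross[of "(1 - k, 0)" "(- k, 0)"] k by (auto simp: side_adjacent_def)
  have VW: "w \<in> W" if "w \<in> V" for w
    using that mW unfolding V_def by (auto elim!: rtranclE simp: S_def)
  have V_step: "b \<in> V" if "a \<in> V" "side_adjacent a b" "b \<in> W" for a b
    using that VW[of a] unfolding V_def by (auto simp: S_def intro: rtrancl_into_rtrancl)
  define F where "F a b \<longleftrightarrow> a \<in> D \<and> b \<notin> D \<and> a \<in> V \<or> b \<in> D \<and> a \<notin> D \<and> b \<in> V" for a b
  have F_commute: "F a b = F b a" for a b by (auto simp: F_def)
  \<comment> \<open>A square that meets \<open>C\<close> has all its corners in \<open>D\<close> within \<open>W\<close>. Hence two of them sharing a side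
    belong to \<open>V\<close> together or not at all; two opposite corners in \<open>D\<close> without a third one lie on
    two edges each.\<close>
  have closed: "(F (i, j) (i + 1, j) \<noteq> F (i, j + 1) (i + 1, j + 1)) =
      (F (i, j) (i, j + 1) \<noteq> F (i + 1, j) (i + 1, j + 1))" for i j
  proof -
    define a b c d where abcd: "a = (i, j)" "b = (i + 1, j)" "c = (i + 1, j + 1)" "d = (i, j + 1)"
    have king: "king_adjacent x y" if "x \<in> {a, b, c, d}" "y \<in> {a, b, c, d}" "x \<noteq> y" for x y
      using that by (auto simp: king_adjacent_def abcd)
    have side: "side_adjacent a b" "side_adjacent b c" "side_adjacent c d" "side_adjacent d a"
      "side_adjacent b a" "side_adjacent c b" "side_adjacent d c" "side_adjacent a d"
      by (auto simp: side_adjacent_def abcd)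
    have C: "x \<in> C" if "x \<notin> D" "y \<in> D" "side_adjacent x y" for x y using cross that by blast
    have near: "y \<in> W" if "x \<in> C" "y \<in> D" "x \<in> {a, b, c, d}" "y \<in> {a, b, c, d}" for x y
      using W_near[of x y] that king[of x y] DC by blast
    have st: "(x \<in> V) = (y \<in> V)" if "x \<in> W" "y \<in> W" "side_adjacent x y" "side_adjacent y x" for x y
      using that V_step by blast
    have CD: "a \<notin> D \<Longrightarrow> b \<in> D \<or> d \<in> D \<Longrightarrow> a \<in> C" "b \<notin> D \<Longrightarrow> a \<in> D \<or> c \<in> D \<Longrightarrow> b \<in> C"
      "c \<notin> D \<Longrightarrow> b \<in> D \<or> d \<in> D \<Longrightarrow> c \<in> C" "d \<notin> D \<Longrightarrow> a \<in> D \<or> c \<in> D \<Longrightarrow> d \<in> C"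
      using C side by blast+
    have WW: "a \<in> D \<Longrightarrow> b \<in> C \<or> c \<in> C \<or> d \<in> C \<Longrightarrow> a \<in> W"
      "b \<in> D \<Longrightarrow> a \<in> C \<or> c \<in> C \<or> d \<in> C \<Longrightarrow> b \<in> W"
      "c \<in> D \<Longrightarrow> b \<in> C \<or> a \<in> C \<or> d \<in> C \<Longrightarrow> c \<in> W"
      "d \<in> D \<Longrightarrow> b \<in> C \<or> c \<in> C \<or> a \<in> C \<Longrightarrow> d \<in> W"
      using near by blast+
    have VV: "a \<in> W \<Longrightarrow> b \<in> W \<Longrightarrow> (a \<in> V) = (b \<in> V)" "b \<in> W \<Longrightarrow> c \<in> W \<Longrightarrow> (b \<in> V) = (c \<in> V)"
       "c \<in> W \<Longrightarrow> d \<in> W \<Longrightarrow> (c \<in> V) = (d \<in> V)" "d \<in> W \<Longrightarrow> a \<in> W \<Longrightarrow> (d \<in> V) = (a \<in> V)"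
      using st side by blast+
    show ?thesis unfolding F_def abcd[symmetric] using CD WW VV by argo
  qed
  obtain g :: "int \<times> int \<Rightarrow> bool" where g: "\<forall>i j. (g (i + 1, j) \<noteq> g (i, j)) = F (i, j) (i + 1, j) \<and>
      (g (i, j + 1) \<noteq> g (i, j)) = F (i, j) (i, j + 1)"
    using closed_cochain_exact[of "\<lambda>i j. F (i, j) (i + 1, j)" "\<lambda>i j. F (i, j) (i, j + 1)", OF closed] ..
  have gF: "(g a \<noteq> g b) = F a b" if "side_adjacent a b" for a b
    using that
  proof (cases rule: side_adjacent_cases)
    case (right i j) then show ?thesis using g[rule_format, of i j] by (cases "g a") simp_all
  next
    case (left i j) then show ?thesis using g[rule_format, of i j] F_commute[of a b] by (cases "g a") simp_all
  next
    case (up i j) then show ?thesis using g[rule_format, of i j] by (cases "g a") simp_all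
  next
    case (down i j) then show ?thesis using g[rule_format, of i j] F_commute[of a b] by (cases "g a") simp_all
  qed
  have gD: "g v = g (B, 0)" if "v \<in> D" for v
  proof -
    from that have "((B, 0), v) \<in> R\<^sup>*" by (simp add: D_def)
    then show ?thesis
    proof induction
      case (step y z)
      then have "y \<in> D" "z \<in> D" by (auto simp: D_def intro: rtrancl_into_rtrancl)
      then have "\<not> F y z" by (simp add: F_def)
      with gF[of y z] step show ?case by (auto simp: R_def)
    qed simp
  qed
  \<comment> \<open>For a diagonal step the two sides of a common corner \<open>x\<close> in \<open>D\<close> contribute twice the same value.\<close>
  have g_king: "g a = g b" if "a \<in> C" "b \<in> C" "king_adjacent a b" for a b
  proof (cases "side_adjacent a b")
    case True
    then show ?thesis using gF[OF True] that DC[of a] DC[of b] by (simp add: F_def) blast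
  next
    case False
    define x where "x = (fst a, snd b)"
    have "side_adjacent a x" "side_adjacent x b"
      using that(3) False by (auto simp: x_def side_adjacent_def king_adjacent_def prod_eq_iff)
    then show ?thesis using gF[of a x] gF[of x b] that DC[of a] DC[of b] by (auto simp: F_def)
  qed
  have gC: "g c = g (0, 0)" if "c \<in> C" for c
    using conn[OF that] by induction (auto dest: g_king)
  have "F (m - 1, 0) (m, 0)" using m by (auto simp: F_def V_def)
  then have "g (0, 0) \<noteq> g (B, 0)"
    using gF[of "(m - 1, 0)" "(m, 0)"] gC[OF mW(1)] gD[OF m(2)] by (auto simp: side_adjacent_def)
  then have "F (1 - k, 0) (- k, 0)"
    using gF[of "(1 - k, 0)" "(- k, 0)"] gC[OF kW(1)] gD[OF k(2)] by (auto simp: side_adjacent_def)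
  then have "(- k, 0) \<in> V" using k by (auto simp: F_def)
  then show ?thesis using m mW k unfolding V_def S_def by force
qed

section \<open>First moments of chordless chains\<close>

text \<open>A chain of \<open>2 * k\<close> linked elements of \<open>S\<close> that starts after \<open>s\<close>, taken in double steps
whose ends are apart. The set \<open>F\<close> collects the elements already used, which makes the
elements of the chain distinct; membership in \<open>S\<close> is tested for all of them together at the
end, so that a single independence statement applies.\<close>

primrec chain_exists ::
    "('s \<Rightarrow> 's \<Rightarrow> bool) \<Rightarrow> ('s \<Rightarrow> 's \<Rightarrow> bool) \<Rightarrow> 's set \<Rightarrow> nat \<Rightarrow> 's \<Rightarrow> 's set \<Rightarrow> bool" where
  "chain_exists linked apart S 0 s F \<longleftrightarrow> F \<subseteq> S"
| "chain_exists linked apart S (Suc k) s F \<longleftrightarrow>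
     (\<exists>t u. linked s t \<and> linked t u \<and> apart s u \<and> t \<notin> F \<and> u \<notin> insert t F \<and>
        chain_exists linked apart S k u (insert u (insert t F)))"

lemma chain_exists_mono:
  "chain_exists linked apart S k s F \<Longrightarrow> S \<subseteq> S' \<Longrightarrow> chain_exists linked apart S' k s F"
  by (induction k arbitrary: s F) auto

text \<open>A shortest path has no shortcut, so its elements are distinct and any two elements at
distance two along the path are neither equal nor linked.\<close>

lemma shortest_path_chain:
  fixes linked apart :: "'s \<Rightarrow> 's \<Rightarrow> bool" and W :: "'s set"
  defines "R \<equiv> {(a, b). a \<in> W \<and> b \<in> W \<and> linked a b}"
  assumes path: "(s, t) \<in> R\<^sup>*" and far: "\<And>n. n < 2 * k \<Longrightarrow> (s, t) \<notin> R ^^ n"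
    and apart: "\<And>a b. a \<in> W \<Longrightarrow> b \<in> W \<Longrightarrow> a \<noteq> b \<Longrightarrow> \<not> linked a b \<Longrightarrow> apart a b"
  shows "chain_exists linked apart W k s {}"
proof -
  define n where "n = (LEAST n. (s, t) \<in> R ^^ n)"
  from path obtain n' where "(s, t) \<in> R ^^ n'" by (auto simp: rtrancl_power)
  then have n: "(s, t) \<in> R ^^ n" unfolding n_def by (rule LeastI)
  have least: "(s, t) \<in> R ^^ m \<Longrightarrow> n \<le> m" for m unfolding n_def by (rule Least_le)
  obtain p where p: "p 0 = s" "p n = t" "\<And>i. i < n \<Longrightarrow> (p i, p (Suc i)) \<in> R"
    using n by (auto simp: relpow_fun_conv)
  have sub: "(p i, p (i + d)) \<in> R ^^ d" if "i + d \<le> n" for i d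
    using that by (induction d) (use p(3) in \<open>auto intro: relcompI\<close>)
  \<comment> \<open>Replacing the part of the path between positions \<open>i\<close> and \<open>i + d\<close> by \<open>m\<close> steps cannot shorten it.\<close>
  have no_shortcut: "d \<le> m" if "i + d \<le> n" "(p i, p (i + d)) \<in> R ^^ m" for i d m
  proof -
    have "(s, p i) \<in> R ^^ i" using sub[of 0 i] that p by simp
    moreover have "(p (i + d), t) \<in> R ^^ (n - (i + d))"
      using sub[of "i + d" "n - (i + d)"] that p by simp
    ultimately have "(s, t) \<in> R ^^ (i + m + (n - (i + d)))"
      unfolding relpow_add using that(2) by (intro relcompI)
    from least[OF this] that(1) show ?thesis by linarith
  qed
  have inj: "p i \<noteq> p j" if "i < j" "j \<le> n" for i j
    using no_shortcut[of i "j - i" 0] that by auto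
  have chordless: "apart (p i) (p (Suc (Suc i)))" if "Suc (Suc i) \<le> n" for i
  proof (rule apart)
    show W: "p i \<in> W" "p (Suc (Suc i)) \<in> W"
      using p(3)[of i] p(3)[of "Suc i"] that by (auto simp: R_def)
    show "p i \<noteq> p (Suc (Suc i))" using inj that by simp
    show "\<not> linked (p i) (p (Suc (Suc i)))"
      using no_shortcut[of i 2 1] that W by (auto simp: R_def)
  qed
  have "chain_exists linked apart W k' (p i) (p ` {0<..i})" if "i + 2 * k' \<le> n" for k' i
    using that
  proof (induction k' arbitrary: i)
    case 0
    have "p j \<in> W" if "0 < j" "j \<le> i" for j using p(3)[of "j - 1"] that 0 by (auto simp: R_def)
    then show ?case by auto
  next
    case (Suc k')
    have "chain_exists linked apart W k' (p (Suc (Suc i))) (p ` {0<..Suc (Suc i)})"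
      using Suc.IH[of "Suc (Suc i)"] Suc.prems by simp
    moreover have "{0<..Suc (Suc i)} = insert (Suc (Suc i)) (insert (Suc i) {0<..i})" by auto
    ultimately have "chain_exists linked apart W k' (p (Suc (Suc i)))
        (insert (p (Suc (Suc i))) (insert (p (Suc i)) (p ` {0<..i})))" by simp
    moreover have "p j' \<notin> p ` {0<..j}" if "j < j'" "j' \<le> n" for j j'
    proof
      assume "p j' \<in> p ` {0<..j}"
      then obtain l where "l \<le> j" "p j' = p l" by auto
      with inj[of l j'] that show False by simp
    qed
    from this[of i "Suc i"] this[of i "Suc (Suc i)"]
    have "p (Suc i) \<notin> p ` {0<..i}" "p (Suc (Suc i)) \<notin> insert (p (Suc i)) (p ` {0<..i})"
      using inj[of "Suc i" "Suc (Suc i)"] Suc.prems by simp_all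
    moreover have "linked (p i) (p (Suc i))" "linked (p (Suc i)) (p (Suc (Suc i)))"
      using p(3)[of i] p(3)[of "Suc i"] Suc.prems by (auto simp: R_def)
    ultimately show ?case using chordless[of i] Suc.prems by fastforce
  qed
  from this[of 0 k] show ?thesis using far[of n] n p(1) by fastforce
qed

context prob_space
begin

text \<open>The expected number of chains is bounded by iterating the two-step operator; \<open>\<phi>\<close> is a
subsolution with ratio \<open>\<theta>\<close>, which plays the role of a Perron eigenvector. The induction
carries the elements already used in \<open>F\<close>, because only the joint probability of all of them
is a product.\<close>

lemma chain_exists_prob_le:
  fixes S :: "'a \<Rightarrow> 's set" and q \<phi> :: "'s \<Rightarrow> real"
  assumes meas: "\<And>F. finite F \<Longrightarrow> {\<omega> \<in> space M. F \<subseteq> S \<omega>} \<in> events"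
    and q: "\<And>s. 0 \<le> q s" and ind: "\<And>F. finite F \<Longrightarrow> prob {\<omega> \<in> space M. F \<subseteq> S \<omega>} \<le> (\<Prod>s\<in>F. q s)"
    and fin: "\<And>s. finite {t. linked s t}" and \<phi>: "\<And>s. 1 \<le> \<phi> s"
    and two_step: "\<And>s. (\<Sum>t | linked s t. q t * (\<Sum>u | linked t u \<and> apart s u. q u * \<phi> u)) \<le> \<theta> * \<phi> s"
    and F: "finite F" and \<theta>: "0 \<le> \<theta>"
  shows "{\<omega> \<in> space M. chain_exists linked apart (S \<omega>) k s F} \<in> events \<and>
    prob {\<omega> \<in> space M. chain_exists linked apart (S \<omega>) k s F} \<le> (\<Prod>s\<in>F. q s) * (\<theta> ^ k * \<phi> s)"
  using F
proof (induction k arbitrary: s F)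
  case 0
  have "prob {\<omega> \<in> space M. F \<subseteq> S \<omega>} \<le> (\<Prod>s\<in>F. q s) * \<phi> s"
    using ind[OF 0] \<phi>[of s] q by (smt (verit) mult_left_mono mult_cancel_left2 prod_nonneg)
  then show ?case using meas[OF 0] by simp
next
  case (Suc k)
  let ?E = "\<lambda>k s F. {\<omega> \<in> space M. chain_exists linked apart (S \<omega>) k s F}"
  let ?T = "{t. linked s t \<and> t \<notin> F}" and ?U = "\<lambda>t. {u. linked t u \<and> apart s u \<and> u \<notin> insert t F}"
  have finT: "finite ?T" "finite (?U t)" for t
    by (rule finite_subset[OF _ fin], blast)+
  have E: "?E (Suc k) s F = (\<Union>t\<in>?T. \<Union>u\<in>?U t. ?E k u (insert u (insert t F)))" by auto
  have ev: "?E k u (insert u (insert t F)) \<in> events" for t u using Suc by simp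
  have pr: "prob (?E k u (insert u (insert t F))) \<le> (\<Prod>s\<in>F. q s) * (q t * (q u * (\<theta> ^ k * \<phi> u)))"
    if "t \<in> ?T" "u \<in> ?U t" for t u
    using Suc.IH[of "insert u (insert t F)" u] Suc.prems that by (simp add: mult_ac)
  have "prob (?E (Suc k) s F) \<le> (\<Sum>t\<in>?T. prob (\<Union>u\<in>?U t. ?E k u (insert u (insert t F))))"
    unfolding E by (rule finite_measure_subadditive_finite[OF finT(1)]) (use ev finT in auto)
  also have "\<dots> \<le> (\<Sum>t\<in>?T. \<Sum>u\<in>?U t. prob (?E k u (insert u (insert t F))))"
    by (intro sum_mono finite_measure_subadditive_finite[OF finT(2)]) (use ev in auto)
  also have "\<dots> \<le> (\<Sum>t\<in>?T. \<Sum>u\<in>?U t. (\<Prod>s\<in>F. q s) * (q t * (q u * (\<theta> ^ k * \<phi> u))))"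
    by (intro sum_mono pr)
  also have "\<dots> \<le> (\<Sum>t | linked s t. \<Sum>u | linked t u \<and> apart s u.
      (\<Prod>s\<in>F. q s) * (q t * (q u * (\<theta> ^ k * \<phi> u))))"
  proof -
    have nn: "0 \<le> (\<Prod>s\<in>F. q s) * (q t * (q u * (\<theta> ^ k * \<phi> u)))" for t u
      using q \<theta> \<phi>[of u] by (intro mult_nonneg_nonneg prod_nonneg) auto
    have "(\<Sum>t\<in>?T. \<Sum>u\<in>?U t. (\<Prod>s\<in>F. q s) * (q t * (q u * (\<theta> ^ k * \<phi> u))))
        \<le> (\<Sum>t\<in>?T. \<Sum>u | linked t u \<and> apart s u. (\<Prod>s\<in>F. q s) * (q t * (q u * (\<theta> ^ k * \<phi> u))))"
      by (intro sum_mono sum_mono2 nn) (auto intro: finite_subset[OF _ fin])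
    also have "\<dots> \<le> (\<Sum>t | linked s t. \<Sum>u | linked t u \<and> apart s u.
        (\<Prod>s\<in>F. q s) * (q t * (q u * (\<theta> ^ k * \<phi> u))))"
      by (intro sum_mono2 sum_nonneg nn) (auto intro: fin)
    finally show ?thesis .
  qed
  also have "\<dots> = (\<Prod>s\<in>F. q s) * \<theta> ^ k *
      (\<Sum>t | linked s t. q t * (\<Sum>u | linked t u \<and> apart s u. q u * \<phi> u))"
    by (simp add: sum_distrib_left mult_ac)
  also have "\<dots> \<le> (\<Prod>s\<in>F. q s) * \<theta> ^ k * (\<theta> * \<phi> s)"
    using q \<theta> by (intro mult_left_mono two_step mult_nonneg_nonneg prod_nonneg) auto
  finally have "prob (?E (Suc k) s F) \<le> (\<Prod>s\<in>F. q s) * (\<theta> ^ Suc k * \<phi> s)" by (simp add: mult_ac)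
  moreover have "?E (Suc k) s F \<in> events" unfolding E using ev finT by (intro sets.finite_UN) auto
  ultimately show ?case by blast
qed

end

section \<open>Seeds of obstruction and their two-step count\<close>

text \<open>Reasons for a cell to be bad: \<open>Void c\<close> stands for the absence of black points in the
cell \<open>c\<close>, and \<open>Red c\<close> for the presence of a red point in \<open>c\<close>.\<close>

datatype seed = Void "int \<times> int" | Red "int \<times> int"

text \<open>Octagons, that is squares of half-width \<open>m\<close> with corners cut off. A red point in \<open>c\<close>
spoils the 45 cells \<open>d\<close> with \<open>near 3 5 c d\<close>. One side step enlarges this octagon to \<open>near 4
6\<close>, and another spoiled octagon to \<open>near 7 11\<close>.\<close>

definition near :: "int \<Rightarrow> int \<Rightarrow> int \<times> int \<Rightarrow> int \<times> int \<Rightarrow> bool" where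
  "near m n c d \<longleftrightarrow> \<bar>fst d - fst c\<bar> \<le> m \<and> \<bar>snd d - snd c\<bar> \<le> m \<and>
     \<bar>fst d - fst c\<bar> + \<bar>snd d - snd c\<bar> \<le> n"

definition annulus :: "int \<Rightarrow> int \<Rightarrow> int \<Rightarrow> int \<Rightarrow> int \<times> int \<Rightarrow> int \<times> int \<Rightarrow> bool" where
  "annulus m n k l c d \<longleftrightarrow> near m n c d \<and> \<not> near k l c d"

text \<open>Two seeds are linked if the cells they spoil can be equal or share a side. A void cell
inside the octagon of a red cell is not linked to it, since such a cell is always attributed
to the red seed.\<close>

fun linked :: "seed \<Rightarrow> seed \<Rightarrow> bool" where
  "linked (Void c) (Void d) = annulus 1 1 0 0 c d"
| "linked (Void c) (Red d) = annulus 4 6 3 5 c d"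
| "linked (Red c) (Void d) = annulus 4 6 3 5 c d"
| "linked (Red c) (Red d) = annulus 7 11 0 0 c d"

text \<open>The relation between the ends of a double step of a shortest chain: they are distinct,
not linked, and a void cell is not inside the octagon of a red one.\<close>

fun apart :: "seed \<Rightarrow> seed \<Rightarrow> bool" where
  "apart (Void c) (Void d) = (\<not> near 1 1 c d)"
| "apart (Void c) (Red d) = (\<not> near 4 6 c d)"
| "apart (Red c) (Void d) = (\<not> near 4 6 c d)"
| "apart (Red c) (Red d) = (\<not> near 7 11 c d)"

definition annulus_list :: "int \<Rightarrow> int \<Rightarrow> int \<Rightarrow> int \<Rightarrow> (int \<times> int) list" where
  "annulus_list m n k l = filter (annulus m n k l (0, 0)) (List.product [-m..m] [-m..m])"

text \<open>The number of pairs \<open>(a, b)\<close> from the two lists of steps for which \<open>a + b\<close> leaves an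
octagon, in a form suited to evaluation by rewriting.\<close>

definition count_list ::
    "(int \<times> int) list \<Rightarrow> (int \<times> int) list \<Rightarrow> int \<Rightarrow> int \<Rightarrow> nat" where
  "count_list A B m n = sum_list
     (map (\<lambda>a. length (filter (\<lambda>b. \<not> near m n (0, 0) (fst a + fst b, snd a + snd b)) B)) A)"

lemma near_translate: "near m n (c + a) (c + b) = near m n a b"
  by (simp add: near_def)

lemma annulus_translate: "annulus m n k l (c + a) (c + b) = annulus m n k l a b"
  by (simp add: annulus_def near_translate)

lemma near_zero: "near 0 0 c d \<longleftrightarrow> c = d"
  by (auto simp: near_def prod_eq_iff)

lemma distinct_annulus_list: "distinct (annulus_list m n k l)"
  by (simp add: annulus_list_def distinct_product)

lemma annulus_eq_image: "{d. annulus m n k l c d} = (+) c ` set (annulus_list m n k l)"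
proof -
  have offsets: "set (annulus_list m n k l) = {a. annulus m n k l (0, 0) a}"
  proof -
    have "fst a \<in> {-m..m} \<and> snd a \<in> {-m..m}" if "annulus m n k l (0, 0) a" for a
      using that unfolding annulus_def near_def by (simp, linarith)
    then show ?thesis by (auto simp: annulus_list_def)
  qed
  have "{d. annulus m n k l c d} = {d. d - c \<in> set (annulus_list m n k l)}"
  proof -
    have "annulus m n k l c d \<longleftrightarrow> annulus m n k l (0, 0) (d - c)" for d
    proof -
      have "c + (0, 0) = c" "c + (d - c) = d" by (simp_all add: prod_eq_iff)
      then show ?thesis using annulus_translate[of m n k l c "(0, 0)" "d - c"] by simp
    qed
    then show ?thesis unfolding offsets by blast
  qed
  also have "\<dots> = (+) c ` set (annulus_list m n k l)"
  proof (intro equalityI subsetI)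
    fix d assume "d \<in> {d. d - c \<in> set (annulus_list m n k l)}"
    then have "c + (d - c) \<in> (+) c ` set (annulus_list m n k l)" by blast
    then show "d \<in> (+) c ` set (annulus_list m n k l)" by simp
  qed auto
  finally show ?thesis .
qed

lemma finite_annulus: "finite {d. annulus m n k l c d}"
  by (simp add: annulus_eq_image)

text \<open>By translation invariance the number of double steps does not depend on the starting
cell.\<close>

lemma two_step_count:
  "(\<Sum>c | annulus m\<^sub>1 n\<^sub>1 k\<^sub>1 l\<^sub>1 z c. card {d. annulus m\<^sub>2 n\<^sub>2 k\<^sub>2 l\<^sub>2 c d \<and> \<not> near m n z d}) =
   count_list (annulus_list m\<^sub>1 n\<^sub>1 k\<^sub>1 l\<^sub>1) (annulus_list m\<^sub>2 n\<^sub>2 k\<^sub>2 l\<^sub>2) m n"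
proof -
  let ?A = "annulus_list m\<^sub>1 n\<^sub>1 k\<^sub>1 l\<^sub>1" and ?B = "annulus_list m\<^sub>2 n\<^sub>2 k\<^sub>2 l\<^sub>2"
  let ?far = "\<lambda>a b. \<not> near m n (0, 0) (fst a + fst b, snd a + snd b)"
  have inner: "card {d. annulus m\<^sub>2 n\<^sub>2 k\<^sub>2 l\<^sub>2 (z + a) d \<and> \<not> near m n z d} = length (filter (?far a) ?B)" for a
  proof -
    have far: "near m n z (z + a + b) = near m n (0, 0) (fst a + fst b, snd a + snd b)" for b
      using near_translate[of m n z 0 "a + b"] by (simp add: zero_prod_def plus_prod_def add.assoc)
    have "{d. annulus m\<^sub>2 n\<^sub>2 k\<^sub>2 l\<^sub>2 (z + a) d \<and> \<not> near m n z d} = (+) (z + a) ` set (filter (?far a) ?B)"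
      using annulus_eq_image[of m\<^sub>2 n\<^sub>2 k\<^sub>2 l\<^sub>2 "z + a"] by (auto simp: far[symmetric] set_eq_iff)
    also have "card \<dots> = length (filter (?far a) ?B)"
      by (simp add: card_image distinct_card distinct_annulus_list del: set_filter)
    finally show ?thesis .
  qed
  have "(\<Sum>c | annulus m\<^sub>1 n\<^sub>1 k\<^sub>1 l\<^sub>1 z c. card {d. annulus m\<^sub>2 n\<^sub>2 k\<^sub>2 l\<^sub>2 c d \<and> \<not> near m n z d}) =
      (\<Sum>a\<in>set ?A. length (filter (?far a) ?B))"
    unfolding annulus_eq_image[of m\<^sub>1] by (simp add: sum.reindex inner)
  then show ?thesis
    unfolding count_list_def by (simp add: sum_list_distinct_conv_sum_set distinct_annulus_list)
qed

text \<open>The letters give the types of the three seeds of a double step, \<open>V\<close> for void and \<open>R\<close>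
for red. Without the restriction to chordless steps the last number would be \<open>200 * 200\<close>.\<close>

lemma count_VVV: "count_list (annulus_list 1 1 0 0) (annulus_list 1 1 0 0) 1 1 = 12"
  by code_simp
lemma count_VVR: "count_list (annulus_list 1 1 0 0) (annulus_list 4 6 3 5) 4 6 = 36"
  by code_simp
lemma count_VRV: "count_list (annulus_list 4 6 3 5) (annulus_list 4 6 3 5) 1 1 = 520"
  by code_simp
lemma count_VRR: "count_list (annulus_list 4 6 3 5) (annulus_list 7 11 0 0) 4 6 = 3296"
  by code_simp
lemma count_RVV: "count_list (annulus_list 4 6 3 5) (annulus_list 1 1 0 0) 4 6 = 36"
  by code_simp
lemma count_RVR: "count_list (annulus_list 4 6 3 5) (annulus_list 4 6 3 5) 7 11 = 128"
  by code_simp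
lemma count_RRV: "count_list (annulus_list 7 11 0 0) (annulus_list 4 6 3 5) 4 6 = 3296"
  by code_simp
lemma count_RRR: "count_list (annulus_list 7 11 0 0) (annulus_list 7 11 0 0) 7 11 = 16796"
  by code_simp

text \<open>Used both for the probabilities of the two types and for the subsolution \<open>\<phi>\<close>.\<close>

fun weight :: "real \<Rightarrow> real \<Rightarrow> seed \<Rightarrow> real" where
  "weight v r (Void c) = v" | "weight v r (Red c) = r"

lemma Collect_seed: "{s. Q s} = Void ` {c. Q (Void c)} \<union> Red ` {c. Q (Red c)}"
proof (rule set_eqI)
  show "s \<in> {s. Q s} \<longleftrightarrow> s \<in> Void ` {c. Q (Void c)} \<union> Red ` {c. Q (Red c)}" for s
    by (cases s) auto
qed

lemma sum_seed:
  fixes f :: "seed \<Rightarrow> real"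
  assumes "finite {c. Q (Void c)}" "finite {c. Q (Red c)}"
  shows "(\<Sum>s | Q s. f s) = (\<Sum>c | Q (Void c). f (Void c)) + (\<Sum>c | Q (Red c). f (Red c))"
proof -
  have "(\<Sum>s | Q s. f s) = (\<Sum>s\<in>Void ` {c. Q (Void c)}. f s) + (\<Sum>s\<in>Red ` {c. Q (Red c)}. f s)"
    unfolding Collect_seed[of Q] by (rule sum.union_disjoint) (use assms in auto)
  then show ?thesis by (simp add: sum.reindex inj_on_def)
qed

lemma finite_linked: "finite {t. linked s t}"
  unfolding Collect_seed[of "linked s"] by (cases s) (simp_all add: finite_annulus)

text \<open>The numbers \<open>0.1075\<close> and \<open>0.0045 = 9/4 * 0.002\<close> bound the probabilities of a void cell
and of a red cell. The matrix of two-step counts weighted by them has spectral radius just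
above \<open>0.8\<close>, and \<open>(1, 5)\<close> is close to its Perron eigenvector.\<close>

lemma two_step_bound:
  fixes v r :: real
  assumes v: "0 \<le> v" "v \<le> 0.1075" and r: "0 \<le> r" "r \<le> 0.0045"
  shows "(\<Sum>t | linked s t. weight v r t * (\<Sum>u | linked t u \<and> apart s u. weight v r u * weight 1 5 u))
     \<le> 0.82 * weight 1 5 s"
proof -
  have fin: "finite {c. linked s (Void c)}" "finite {c. linked s (Red c)}" for s
    by (cases s; simp add: finite_annulus)+
  have fin2: "finite {c. linked s (Void c) \<and> P c}" "finite {c. linked s (Red c) \<and> P c}" for s P
    by (rule finite_subset[OF _ fin(1)[of s]], blast) (rule finite_subset[OF _ fin(2)[of s]], blast)
  let ?nV = "\<lambda>t. card {d. linked t (Void d) \<and> apart s (Void d)}"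
  let ?nR = "\<lambda>t. card {d. linked t (Red d) \<and> apart s (Red d)}"
  have inner: "(\<Sum>u | linked t u \<and> apart s u. weight v r u * weight 1 5 u) = v * ?nV t + 5 * r * ?nR t" for t
    by (subst sum_seed) (simp_all add: fin2)
  have "(\<Sum>t | linked s t. weight v r t * (\<Sum>u | linked t u \<and> apart s u. weight v r u * weight 1 5 u)) =
      (\<Sum>c | linked s (Void c). v * (v * ?nV (Void c) + 5 * r * ?nR (Void c))) +
      (\<Sum>c | linked s (Red c). r * (v * ?nV (Red c) + 5 * r * ?nR (Red c)))"
    unfolding inner by (subst sum_seed[OF fin]) simp
  also have "\<dots> = v * (v * (\<Sum>c | linked s (Void c). ?nV (Void c)) + 5 * r * (\<Sum>c | linked s (Void c). ?nR (Void c)))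
     + r * (v * (\<Sum>c | linked s (Red c). ?nV (Red c)) + 5 * r * (\<Sum>c | linked s (Red c). ?nR (Red c)))"
    unfolding of_nat_sum by (simp only: sum_distrib_left sum.distrib distrib_left mult.assoc)
  also have "\<dots> \<le> 0.82 * weight 1 5 s"
  proof -
    have m: "v * v \<le> 0.1075 * 0.1075" "v * r \<le> 0.1075 * 0.0045" "r * r \<le> 0.0045 * 0.0045"
      using v r by (intro mult_mono; simp)+
    show ?thesis
    proof (cases s)
      case (Void c)
      then show ?thesis using m
        by (simp add: two_step_count count_VVV count_VVR count_VRV count_VRR algebra_simps)
    next
      case (Red c)
      then show ?thesis using m
        by (simp add: two_step_count count_RVV count_RVR count_RRV count_RRR algebra_simps)
    qed
  qed
  finally show ?thesis .
qed

section \<open>Poisson processes on a square grid\<close>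

text \<open>The mesh \<open>h\<close> is arbitrary: percolation uses \<open>3/2\<close>, measurability all dyadic meshes.\<close>

definition grid_index :: "real \<Rightarrow> real ^ 2 \<Rightarrow> int \<times> int" where
  "grid_index h x = (\<lfloor>x $ 1 / h\<rfloor>, \<lfloor>x $ 2 / h\<rfloor>)"

definition grid_cell :: "real \<Rightarrow> int \<times> int \<Rightarrow> (real ^ 2) set" where
  "grid_cell h c = {x. grid_index h x = c}"

lemma grid_cell_iff:
  assumes "0 < h"
  shows "x \<in> grid_cell h c \<longleftrightarrow> h * real_of_int (fst c) \<le> x $ 1 \<and> x $ 1 < h * (real_of_int (fst c) + 1) \<and>
    h * real_of_int (snd c) \<le> x $ 2 \<and> x $ 2 < h * (real_of_int (snd c) + 1)"
  using assms
  by (cases c) (auto simp: grid_cell_def grid_index_def floor_eq_iff pos_le_divide_eq pos_divide_less_eq mult.commute)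

lemma grid_cell_borel [measurable]: "grid_cell h c \<in> sets borel"
proof -
  have "grid_cell h c = {x. \<lfloor>x $ 1 / h\<rfloor> = fst c \<and> \<lfloor>x $ 2 / h\<rfloor> = snd c}"
    by (auto simp: grid_cell_def grid_index_def)
  also have "\<dots> \<in> sets borel" by measurable
  finally show ?thesis .
qed

lemma grid_cell_between:
  fixes c :: "int \<times> int"
  defines "k \<equiv> \<lambda>i::2. real_of_int (if i = 1 then fst c else snd c)"
  assumes "0 < h"
  shows "box (\<chi> i. h * k i) (\<chi> i. h * (k i + 1)) \<subseteq> grid_cell h c"
    "grid_cell h c \<subseteq> cbox (\<chi> i. h * k i) (\<chi> i. h * (k i + 1))"
  using assms by (auto simp: grid_cell_iff mem_box_cart forall_2)

lemma grid_cell_bounded: "0 < h \<Longrightarrow> bounded (grid_cell h c)"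
  using grid_cell_between(2) bounded_cbox bounded_subset by blast

text \<open>A half-open cell lies between an open and a closed box of the same volume.\<close>

lemma measure_grid_cell:
  assumes "0 < h"
  shows "measure lborel (grid_cell h c) = h ^ 2"
proof -
  let ?a = "(\<chi> i. h * real_of_int (if i = 1 then fst c else snd c)) :: real ^ 2"
  let ?b = "(\<chi> i. h * (real_of_int (if i = 1 then fst c else snd c) + 1)) :: real ^ 2"
  have le: "cbox ?a ?b \<noteq> {}" using assms by (simp add: interval_ne_empty_cart)
  have "measure lborel (cbox ?a ?b) = h ^ 2"
    by (subst content_cbox_cart[OF le]) (simp add: UNIV_2 algebra_simps power2_eq_square)
  moreover have "measure lborel (box ?a ?b) = measure lborel (cbox ?a ?b)"
    by (simp add: measure_def emeasure_lborel_box_eq emeasure_lborel_cbox_eq)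
  moreover have "measure lborel (box ?a ?b) \<le> measure lborel (grid_cell h c)"
    "measure lborel (grid_cell h c) \<le> measure lborel (cbox ?a ?b)"
    using grid_cell_between[OF assms, of c] grid_cell_bounded[OF assms, of c]
      emeasure_bounded_finite[OF grid_cell_bounded[OF assms, of c]]
    by (auto intro!: measure_mono_fmeasurable simp: fmeasurable_def emeasure_lborel_cbox_finite)
  ultimately show ?thesis by linarith
qed

lemma disjoint_family_grid_cell: "disjoint_family_on (grid_cell h) J"
  by (auto simp: disjoint_family_on_def grid_cell_def)

lemma space_configurations:
  "space (configurations :: 'a::euclidean_space set measure) = locally_finite_sets"
  unfolding configurations_def by (rule space_measure_of) auto

lemma configurations_locally_finite:
  assumes "poisson_process M c N" "\<omega> \<in> space M"
  shows "N \<omega> \<in> locally_finite_sets"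
  using assms measurable_space[of N M configurations]
  by (auto simp: poisson_process_def space_configurations)

lemma count_set_configurations:
  assumes "A \<in> sets borel" "bounded A"
  shows "{S \<in> locally_finite_sets. card (S \<inter> A) \<in> B} \<in> sets configurations"
proof -
  have "{S \<in> locally_finite_sets. card (S \<inter> A) = k} \<in> sets configurations" for k
    using assms unfolding configurations_def by (subst sets_measure_of) auto
  then have "(\<Union>k\<in>B. {S \<in> locally_finite_sets. card (S \<inter> A) = k}) \<in> sets configurations"
    by (intro sets.countable_UN') auto
  moreover have "{S \<in> locally_finite_sets. card (S \<inter> A) \<in> B} =
      (\<Union>k\<in>B. {S \<in> locally_finite_sets. card (S \<inter> A) = k})" by auto
  ultimately show ?thesis by simp
qed

lemma count_measurable:
  assumes "poisson_process M c N" "A \<in> sets borel" "bounded A"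
  shows "(\<lambda>\<omega>. card (N \<omega> \<inter> A)) \<in> measurable M (count_space UNIV)"
proof -
  have "(\<lambda>S. card (S \<inter> A)) \<in> measurable configurations (count_space UNIV)"
  proof (rule measurableI)
    fix B :: "nat set"
    have "(\<lambda>S. card (S \<inter> A)) -` B \<inter> space configurations = {S \<in> locally_finite_sets. card (S \<inter> A) \<in> B}"
      by (auto simp: space_configurations)
    then show "(\<lambda>S. card (S \<inter> A)) -` B \<inter> space configurations \<in> sets configurations"
      using count_set_configurations[OF assms(2,3)] by simp
  qed auto
  moreover have "N \<in> measurable M configurations" using assms by (simp add: poisson_process_def)
  ultimately show ?thesis by measurable
qed

text \<open>Independence of the counts in finitely many disjoint sets, for families indexed by an
arbitrary finite set instead of an initial segment of \<open>\<nat>\<close>.\<close>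

lemma poisson_counts_product:
  assumes N: "poisson_process M c N" and J: "finite J" and disj: "disjoint_family_on A J"
    and A: "\<And>j. j \<in> J \<Longrightarrow> A j \<in> sets borel \<and> bounded (A j)"
  shows "measure M {\<omega> \<in> space M. \<forall>j\<in>J. card (N \<omega> \<inter> A j) \<in> B} =
    (\<Prod>j\<in>J. measure M {\<omega> \<in> space M. card (N \<omega> \<inter> A j) \<in> B})"
proof (cases "J = {}")
  case True
  interpret prob_space M using N by (simp add: poisson_process_def)
  from True show ?thesis by (simp add: prob_space)
next
  case False
  interpret prob_space M using N by (simp add: poisson_process_def)
  obtain f where f: "bij_betw f {..<card J} J"
    using J ex_bij_betw_nat_finite[of J] by (auto simp: atLeast0LessThan)
  then have fJ: "f ` {..<card J} = J" "inj_on f {..<card J}" by (auto simp: bij_betw_def)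
  have indep: "indep_vars (\<lambda>_. count_space UNIV) (\<lambda>i \<omega>. card (N \<omega> \<inter> A (f i))) {..<card J}"
  proof -
    have "disjoint_family_on (\<lambda>i. A (f i)) {..<card J}"
      using disj fJ unfolding disjoint_family_on_def inj_on_def by blast
    moreover have "\<forall>i<card J. A (f i) \<in> sets borel \<and> bounded (A (f i))" using A fJ(1) by blast
    ultimately show ?thesis
      using N unfolding poisson_process_def by (elim conjE allE[of _ "\<lambda>i. A (f i)"]) blast
  qed
  have J_ne: "{..<card J} \<noteq> {}" using False J by (simp add: lessThan_empty_iff)
  from indep_varsD[OF indep, of "{..<card J}" "\<lambda>_. B"]
  have "prob (\<Inter>i\<in>{..<card J}. (\<lambda>\<omega>. card (N \<omega> \<inter> A (f i))) -` B \<inter> space M) =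
      (\<Prod>i<card J. prob ((\<lambda>\<omega>. card (N \<omega> \<inter> A (f i))) -` B \<inter> space M))"
    using J_ne by simp
  moreover have "(\<Inter>i\<in>{..<card J}. (\<lambda>\<omega>. card (N \<omega> \<inter> A (f i))) -` B \<inter> space M) =
      {\<omega> \<in> space M. \<forall>j\<in>J. card (N \<omega> \<inter> A j) \<in> B}"
  proof -
    have "(\<forall>j\<in>J. card (N \<omega> \<inter> A j) \<in> B) \<longleftrightarrow> (\<forall>i<card J. card (N \<omega> \<inter> A (f i)) \<in> B)" for \<omega>
    proof -
      have "(\<forall>j\<in>f ` {..<card J}. card (N \<omega> \<inter> A j) \<in> B) \<longleftrightarrow> (\<forall>i<card J. card (N \<omega> \<inter> A (f i)) \<in> B)"
        by auto
      then show ?thesis by (simp only: fJ(1))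
    qed
    then show ?thesis using J_ne by auto
  qed
  moreover have "(\<Prod>i<card J. prob ((\<lambda>\<omega>. card (N \<omega> \<inter> A (f i))) -` B \<inter> space M)) =
      (\<Prod>j\<in>J. prob {\<omega> \<in> space M. card (N \<omega> \<inter> A j) \<in> B})"
    using prod.reindex_bij_betw[OF f, of "\<lambda>j. prob {\<omega> \<in> space M. card (N \<omega> \<inter> A j) \<in> B}"]
    by (simp add: vimage_def Int_def conj_commute)
  ultimately show ?thesis by simp
qed

text \<open>The mesh \<open>3/2\<close> balances the two types of seeds at \<open>\<lambda> = 0.002\<close>: larger cells are rarely
void, but a red point then spoils a larger region.\<close>

definition seeds :: "(real ^ 2) set \<Rightarrow> (real ^ 2) set \<Rightarrow> seed set" where
  "seeds P P' = {s. case s of Void c \<Rightarrow> P \<inter> grid_cell (3/2) c = {} | Red c \<Rightarrow> P' \<inter> grid_cell (3/2) c \<noteq> {}}"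

text \<open>Seeds are independent: voids involve the black process in disjoint cells, red seeds the
red process in disjoint cells, and the two processes are independent.\<close>

lemma seeds_prob:
  fixes P P' :: "'w \<Rightarrow> (real ^ 2) set"
  assumes proc: "independent_poisson_processes M 1 P l P'" and F: "finite F"
  shows "{\<omega> \<in> space M. F \<subseteq> seeds (P \<omega>) (P' \<omega>)} \<in> sets M \<and>
    measure M {\<omega> \<in> space M. F \<subseteq> seeds (P \<omega>) (P' \<omega>)} = (\<Prod>s\<in>F. weight (exp (- 9/4)) (1 - exp (- (9/4 * l))) s)"
proof -
  have N: "poisson_process M 1 P" and N': "poisson_process M l P'"
    using proc by (auto simp: independent_poisson_processes_def)
  interpret prob_space M using N by (simp add: poisson_process_def)
  let ?Q = "grid_cell (3/2)"
  have bd: "bounded (?Q c)" for c by (rule grid_cell_bounded) simp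
  have Q: "?Q c \<in> sets borel \<and> bounded (?Q c)" for c using bd by simp
  define V R where "V = {c. Void c \<in> F}" and "R = {c. Red c \<in> F}"
  have VR: "F = Void ` V \<union> Red ` R" unfolding V_def R_def using Collect_seed[of "\<lambda>s. s \<in> F"] by simp
  have finVR: "finite V" "finite R"
    unfolding V_def R_def using F by (auto intro!: finite_vimageI[unfolded vimage_def] simp: inj_on_def)
  define EV where "EV = {S \<in> locally_finite_sets. \<forall>c\<in>V. card (S \<inter> ?Q c) \<in> {0}}"
  define ER where "ER = {S \<in> locally_finite_sets. \<forall>c\<in>R. card (S \<inter> ?Q c) \<in> - {0}}"
  have sets: "{S \<in> locally_finite_sets. \<forall>c\<in>J. card (S \<inter> ?Q c) \<in> B} \<in> sets configurations"
    if "finite J" for J B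
    using that
  proof induction
    case empty
    have "locally_finite_sets \<in> sets (configurations :: (real ^ 2) set measure)"
      using sets.top[of "configurations :: (real ^ 2) set measure"] by (simp add: space_configurations)
    then show ?case by simp
  next
    case (insert c J)
    have "{S \<in> locally_finite_sets. \<forall>c\<in>insert c J. card (S \<inter> ?Q c) \<in> B} =
        {S \<in> locally_finite_sets. card (S \<inter> ?Q c) \<in> B} \<inter> {S \<in> locally_finite_sets. \<forall>c\<in>J. card (S \<inter> ?Q c) \<in> B}"
      by auto
    with insert count_set_configurations[OF grid_cell_borel bd] show ?case by (auto intro!: sets.Int)
  qed
  have EV: "EV \<in> sets configurations" and ER: "ER \<in> sets configurations"
    unfolding EV_def ER_def using sets finVR by blast+
  have lf: "P \<omega> \<in> locally_finite_sets" "P' \<omega> \<in> locally_finite_sets" if "\<omega> \<in> space M" for \<omega>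
    using configurations_locally_finite[OF N that] configurations_locally_finite[OF N' that] by simp_all
  have event: "{\<omega> \<in> space M. F \<subseteq> seeds (P \<omega>) (P' \<omega>)} = (\<lambda>\<omega>. (P \<omega>, P' \<omega>)) -` (EV \<times> ER) \<inter> space M"
  proof -
    have fin: "finite (P \<omega> \<inter> ?Q c)" "finite (P' \<omega> \<inter> ?Q c)" if "\<omega> \<in> space M" for \<omega> c
      using lf[OF that] bd[of c] by (auto simp: locally_finite_sets_def)
    have "F \<subseteq> seeds (P \<omega>) (P' \<omega>) \<longleftrightarrow> P \<omega> \<in> EV \<and> P' \<omega> \<in> ER" if "\<omega> \<in> space M" for \<omega>
      using lf[OF that] fin[OF that]
      by (simp add: VR image_subset_iff seeds_def EV_def ER_def card_gt_0_iff)
    then show ?thesis by auto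
  qed
  have "prob {\<omega> \<in> space M. F \<subseteq> seeds (P \<omega>) (P' \<omega>)} = prob (P -` EV \<inter> space M) * prob (P' -` ER \<inter> space M)"
    unfolding event using proc EV ER
    by (intro indep_varD[of configurations P configurations P']) (auto simp: independent_poisson_processes_def)
  also have "P -` EV \<inter> space M = {\<omega> \<in> space M. \<forall>c\<in>V. card (P \<omega> \<inter> ?Q c) \<in> {0}}"
    unfolding EV_def using lf by auto
  also have "prob \<dots> = (\<Prod>c\<in>V. prob {\<omega> \<in> space M. card (P \<omega> \<inter> ?Q c) \<in> {0}})"
    by (rule poisson_counts_product[OF N finVR(1) disjoint_family_grid_cell Q])
  also have "\<dots> = (\<Prod>c\<in>V. exp (- 9/4))"
  proof (rule prod.cong)
    fix c
    have "prob {\<omega> \<in> space M. card (P \<omega> \<inter> ?Q c) = 0} = exp (- measure lborel (?Q c))"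
      using N Q[of c] unfolding poisson_process_def by auto
    then show "prob {\<omega> \<in> space M. card (P \<omega> \<inter> ?Q c) \<in> {0}} = exp (- 9/4)"
      by (simp add: measure_grid_cell power2_eq_square)
  qed simp
  also have "P' -` ER \<inter> space M = {\<omega> \<in> space M. \<forall>c\<in>R. card (P' \<omega> \<inter> ?Q c) \<in> - {0}}"
    unfolding ER_def using lf by auto
  also have "prob \<dots> = (\<Prod>c\<in>R. prob {\<omega> \<in> space M. card (P' \<omega> \<inter> ?Q c) \<in> - {0}})"
    by (rule poisson_counts_product[OF N' finVR(2) disjoint_family_grid_cell Q])
  also have "\<dots> = (\<Prod>c\<in>R. 1 - exp (- (9/4 * l)))"
  proof (rule prod.cong)
    fix c
    have [measurable]: "(\<lambda>\<omega>. card (P' \<omega> \<inter> ?Q c)) \<in> measurable M (count_space UNIV)"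
      using count_measurable[OF N'] Q by blast
    have ev: "{\<omega> \<in> space M. card (P' \<omega> \<inter> ?Q c) = 0} \<in> events" by measurable
    have "prob {\<omega> \<in> space M. card (P' \<omega> \<inter> ?Q c) = 0} = exp (- (l * measure lborel (?Q c)))"
      using N' Q[of c] unfolding poisson_process_def by auto
    moreover have "{\<omega> \<in> space M. card (P' \<omega> \<inter> ?Q c) \<in> - {0}} = space M - {\<omega> \<in> space M. card (P' \<omega> \<inter> ?Q c) = 0}"
      by auto
    ultimately show "prob {\<omega> \<in> space M. card (P' \<omega> \<inter> ?Q c) \<in> - {0}} = 1 - exp (- (9/4 * l))"
      using prob_compl[OF ev] by (simp add: measure_grid_cell power2_eq_square mult.commute)
  qed simp
  finally have pr: "prob {\<omega> \<in> space M. F \<subseteq> seeds (P \<omega>) (P' \<omega>)} = (\<Prod>c\<in>V. exp (- 9/4)) * (\<Prod>c\<in>R. 1 - exp (- (9/4 * l)))" .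
  have "(\<Prod>s\<in>F. weight (exp (- 9/4)) (1 - exp (- (9/4 * l))) s) =
      (\<Prod>s\<in>Void ` V. weight (exp (- 9/4)) (1 - exp (- (9/4 * l))) s) * (\<Prod>s\<in>Red ` R. weight (exp (- 9/4)) (1 - exp (- (9/4 * l))) s)"
    unfolding VR by (rule prod.union_disjoint) (use finVR in auto)
  also have "\<dots> = (\<Prod>c\<in>V. exp (- 9/4)) * (\<Prod>c\<in>R. 1 - exp (- (9/4 * l)))"
    by (simp add: prod.reindex inj_on_def)
  finally have "prob {\<omega> \<in> space M. F \<subseteq> seeds (P \<omega>) (P' \<omega>)} = (\<Prod>s\<in>F. weight (exp (- 9/4)) (1 - exp (- (9/4 * l))) s)"
    using pr by simp
  moreover have "{\<omega> \<in> space M. F \<subseteq> seeds (P \<omega>) (P' \<omega>)} \<in> events"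
  proof -
    have [measurable]: "(\<lambda>\<omega>. card (P \<omega> \<inter> ?Q c)) \<in> measurable M (count_space UNIV)"
      "(\<lambda>\<omega>. card (P' \<omega> \<inter> ?Q c)) \<in> measurable M (count_space UNIV)" for c
      using count_measurable[OF N] count_measurable[OF N'] Q by blast+
    have "{\<omega> \<in> space M. F \<subseteq> seeds (P \<omega>) (P' \<omega>)} =
        {\<omega> \<in> space M. (\<forall>c\<in>V. card (P \<omega> \<inter> ?Q c) = 0) \<and> (\<forall>c\<in>R. card (P' \<omega> \<inter> ?Q c) \<noteq> 0)}"
      unfolding event EV_def ER_def using lf by auto
    also have "\<dots> \<in> events" using finVR by measurable
    finally show ?thesis .
  qed
  ultimately show ?thesis by blast
qed

section \<open>Percolation of good cells\<close>

definition good :: "seed set \<Rightarrow> int \<times> int \<Rightarrow> bool" where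
  "good S c \<longleftrightarrow> Void c \<notin> S \<and> (\<forall>d. near 3 5 d c \<longrightarrow> Red d \<notin> S)"

definition good_steps :: "seed set \<Rightarrow> ((int \<times> int) \<times> (int \<times> int)) set" where
  "good_steps S = {(a, b). good S a \<and> good S b \<and> king_adjacent a b}"

text \<open>The seeds that can spoil the cell \<open>(m, 0)\<close>.\<close>

definition starts :: "nat \<Rightarrow> seed set" where
  "starts m = insert (Void (int m, 0)) (Red ` {d. near 3 5 (int m, 0) d})"

fun cell_of :: "seed \<Rightarrow> int \<times> int" where
  "cell_of (Void c) = c" | "cell_of (Red c) = c"

lemma near_commute: "near m n c d \<longleftrightarrow> near m n d c"
  by (simp add: near_def abs_minus_commute)

lemma near_trans: "near m n a b \<Longrightarrow> near k l b c \<Longrightarrow> near (m + k) (n + l) a c"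
  unfolding near_def by linarith

lemma side_adjacent_near: "side_adjacent a b \<Longrightarrow> near 1 1 a b"
  unfolding near_def side_adjacent_def by linarith

lemma side_adjacent_neq: "side_adjacent a b \<Longrightarrow> a \<noteq> b"
  by (auto simp: side_adjacent_def)

lemma linked_near: "linked s t \<Longrightarrow> near 7 11 (cell_of s) (cell_of t)"
  by (cases s; cases t) (auto simp: annulus_def near_def)

text \<open>A chain of seeds advances by at most 7 cells per step, which forces blocking chains to
be long.\<close>

lemma relpow_near:
  assumes "(s, t) \<in> {(a, b). a \<in> W \<and> b \<in> W \<and> linked a b} ^^ n"
  shows "\<bar>fst (cell_of t) - fst (cell_of s)\<bar> \<le> 7 * int n"
  using assms
proof (induction n arbitrary: t)
  case (Suc n)
  then obtain u where "(s, u) \<in> {(a, b). a \<in> W \<and> b \<in> W \<and> linked a b} ^^ n" "linked u t" by auto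
  from Suc.IH[OF this(1)] linked_near[OF this(2)] show ?case unfolding near_def by (simp, linarith)
qed simp

text \<open>Choose a seed for every bad cell, a red one whenever there is one. This preference
guarantees that no chosen void cell lies in the octagon of a chosen red cell, so two
distinct chosen seeds are linked or apart, and a shortest path among them is a chain. A side
path of bad cells from \<open>(m, 0)\<close> to the left half plane crosses at least \<open>m - 5\<close> columns of
seed cells; \<open>m div 14\<close> double steps of at most \<open>14\<close> columns fit in.\<close>

lemma bad_path_chain:
  assumes path: "(c, c') \<in> {(a, b). \<not> good S a \<and> \<not> good S b \<and> side_adjacent a b}\<^sup>*"
    and c: "c = (int m, 0)" "\<not> good S c" and c': "fst c' < 0"
  shows "\<exists>s\<in>starts m. chain_exists linked apart S (m div 14) s {}"
proof -
  define wit where "wit c = (if \<exists>d. near 3 5 d c \<and> Red d \<in> S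
      then Red (SOME d. near 3 5 d c \<and> Red d \<in> S) else Void c)" for c
  have Red: "near 3 5 d c \<and> Red d \<in> S" if "wit c = Red d" for c d
  proof -
    from that have "\<exists>d. near 3 5 d c \<and> Red d \<in> S" and d: "d = (SOME d. near 3 5 d c \<and> Red d \<in> S)"
      by (auto simp: wit_def split: if_splits)
    then show ?thesis unfolding d by (metis (mono_tags, lifting) someI_ex)
  qed
  have Void: "d = c \<and> (\<forall>d. near 3 5 d c \<longrightarrow> Red d \<notin> S)" if "wit c = Void d" for c d
    using that by (auto simp: wit_def split: if_splits)
  have wit_S: "wit c \<in> S" if "\<not> good S c" for c
    using that Red[of c] Void[of c] by (cases "wit c") (auto simp: good_def)
  define W where "W = wit ` {c. \<not> good S c}"
  define R where "R = {(a, b). a \<in> W \<and> b \<in> W \<and> linked a b}"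
  have step: "wit a = wit b \<or> linked (wit a) (wit b)" if ab: "side_adjacent a b" for a b
  proof (cases "wit a"; cases "wit b")
    fix x y assume xy: "wit a = Void x" "wit b = Void y"
    then show ?thesis
      using Void[of a x] Void[of b y] ab side_adjacent_near[OF ab] side_adjacent_neq[OF ab]
      by (simp add: annulus_def near_zero)
  next
    fix x y assume xy: "wit a = Void x" "wit b = Red y"
    have "near 4 6 y a"
      using near_trans[of 3 5 y b 1 1 a] Red[OF xy(2)] side_adjacent_near[OF ab] by (simp add: near_commute)
    moreover have "x = a" "\<not> near 3 5 y a" using Void[OF xy(1)] Red[OF xy(2)] by blast+
    ultimately show ?thesis using xy by (simp add: annulus_def near_commute[of _ _ a y])
  next
    fix x y assume xy: "wit a = Red x" "wit b = Void y"
    have "near 4 6 x b"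
      using near_trans[of 3 5 x a 1 1 b] Red[OF xy(1)] side_adjacent_near[OF ab] by simp
    moreover have "y = b" "\<not> near 3 5 x b" using Void[OF xy(2)] Red[OF xy(1)] by blast+
    ultimately show ?thesis using xy by (simp add: annulus_def)
  next
    fix x y assume xy: "wit a = Red x" "wit b = Red y"
    have "near 4 6 x b"
      using near_trans[of 3 5 x a 1 1 b] Red[OF xy(1)] side_adjacent_near[OF ab] by simp
    then have "near 7 11 x y"
      using near_trans[of 4 6 x b 3 5 y] Red[OF xy(2)] by (simp add: near_commute)
    then show ?thesis using xy by (simp add: annulus_def near_zero)
  qed
  have path': "(wit c, wit c') \<in> R\<^sup>*"
    using path
  proof induction
    case (step y z)
    then have "wit y = wit z \<or> (wit y, wit z) \<in> R"
      using \<open>\<And>a b. side_adjacent a b \<Longrightarrow> _ a b\<close>[of y z] by (auto simp: R_def W_def)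
    with step.IH show ?case by (metis rtrancl.rtrancl_into_rtrancl)
  qed simp
  have cell: "\<bar>fst (cell_of (wit x)) - fst x\<bar> \<le> 3" for x
    using Red[of x] Void[of x] by (cases "wit x") (auto simp: near_def)
  have far: "(wit c, wit c') \<notin> R ^^ n" if "n < 2 * (m div 14)" for n
  proof
    assume "(wit c, wit c') \<in> R ^^ n"
    from relpow_near[OF this[unfolded R_def]] cell[of c] cell[of c'] c c'
    have "int m - 5 \<le> 7 * int n" by simp
    moreover have "7 * n + 7 \<le> m" using that by linarith
    ultimately show False by linarith
  qed
  have "chain_exists linked apart W (m div 14) (wit c) {}"
  proof (rule shortest_path_chain)
    show "(wit c, wit c') \<in> {(a, b). a \<in> W \<and> b \<in> W \<and> linked a b}\<^sup>*" using path' by (simp add: R_def)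
    show "(wit c, wit c') \<notin> {(a, b). a \<in> W \<and> b \<in> W \<and> linked a b} ^^ n" if "n < 2 * (m div 14)" for n
      using far that by (simp add: R_def)
    fix a b assume ab: "a \<in> W" "b \<in> W" "a \<noteq> b" "\<not> linked a b"
    from ab(1,2) obtain x y where "wit x = a" "wit y = b" by (auto simp: W_def)
    then show "apart a b"
      using ab(3,4) Void[of x] Void[of y] Red[of x] Red[of y]
      by (cases a; cases b) (auto simp: annulus_def near_zero near_commute)
  qed
  moreover have "W \<subseteq> S" using wit_S by (auto simp: W_def)
  moreover have "wit c \<in> starts m"
    using Red[of c] Void[of c] c by (cases "wit c") (auto simp: starts_def near_commute)
  ultimately have "chain_exists linked apart S (m div 14) (wit c) {}" "wit c \<in> starts m"
    by (simp_all add: chain_exists_mono[of linked apart W])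
  then show ?thesis ..
qed

text \<open>Let \<open>C\<close> consist of the segment \<open>A\<close> of the first axis and of everything reached from it
by king moves into good cells. All neighbours of \<open>C\<close> outside of \<open>C\<close> are bad. If \<open>C\<close> is
finite, its outer boundary is therefore a blocking circuit that crosses the axis to the
right of the segment; otherwise one of the finitely many good cells next to the segment has
an infinite cluster.\<close>

lemma infinite_cluster_or_chain:
  assumes no_chain: "\<And>m s. N < m \<Longrightarrow> s \<in> starts m \<Longrightarrow> \<not> chain_exists linked apart S (m div 14) s {}"
  shows "\<exists>c. good S c \<and> infinite {d. (c, d) \<in> (good_steps S)\<^sup>*}"
proof -
  define R where "R = {(u, v). king_adjacent u v \<and> good S v}"
  define A where "A = (\<lambda>k. (int k, 0 :: int)) ` {0..N}"
  define C where "C = R\<^sup>* `` A"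
  have "infinite C"
  proof
    assume fin: "finite C"
    have AC: "A \<subseteq> C" by (auto simp: C_def)
    have axis: "(k, 0) \<in> C" if "0 \<le> k" "k \<le> int N" for k
      using that AC by (auto simp: A_def intro!: image_eqI[of _ _ "nat k"])
    define K where "K = {(a, b). a \<in> C \<and> b \<in> C \<and> king_adjacent a b}"
    have conn: "((0, 0), c) \<in> K\<^sup>*" if "c \<in> C" for c
    proof -
      from that obtain k where k: "k \<le> N" "((int k, 0), c) \<in> R\<^sup>*" by (auto simp: C_def A_def)
      have "((0, 0), (int k, 0)) \<in> {(a, b). a \<in> C \<and> b \<in> C \<and> side_adjacent a b}\<^sup>*"
        using line_path[of "int k" "\<lambda>t. (t, 0)" C] axis k(1) by (simp add: side_adjacent_def)
      then have "((0, 0), (int k, 0)) \<in> K\<^sup>*"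
        by (rule rtrancl_mono[THEN subsetD, rotated]) (auto simp: K_def side_adjacent_def king_adjacent_def)
      moreover have "((int k, 0), c) \<in> K\<^sup>*"
        using k(2)
      proof induction
        case (step y z)
        have "y \<in> C" "z \<in> C" using step(1,2) k(1) unfolding C_def A_def
          by (auto intro: rtrancl_into_rtrancl)
        then have "(y, z) \<in> K" using step(2) by (auto simp: K_def R_def)
        with step.IH show ?case by (rule rtrancl_into_rtrancl)
      qed simp
      ultimately show ?thesis by simp
    qed
    let ?W = "{w. w \<notin> C \<and> (\<exists>c\<in>C. king_adjacent c w)}"
    have "\<exists>m w. int N < m \<and> (m, 0) \<in> ?W \<and> fst w < 0 \<and>
        ((m, 0), w) \<in> {(a, b). a \<in> ?W \<and> b \<in> ?W \<and> side_adjacent a b}\<^sup>*"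
      by (rule finite_cluster_boundary[OF fin]) (use axis conn in \<open>auto simp: K_def\<close>)
    then obtain m w where mw: "int N < m" "(m, 0) \<in> ?W" "fst w < 0"
      "((m, 0), w) \<in> {(a, b). a \<in> ?W \<and> b \<in> ?W \<and> side_adjacent a b}\<^sup>*"
      by (elim exE conjE)
    have bad: "\<not> good S w" if "w \<in> ?W" for w
    proof
      assume "good S w"
      from that obtain c where "c \<in> C" "king_adjacent c w" "w \<notin> C" by blast
      with \<open>good S w\<close> have "(c, w) \<in> R" by (simp add: R_def)
      with \<open>c \<in> C\<close> have "w \<in> C" unfolding C_def by (meson Image_iff rtrancl_into_rtrancl)
      with \<open>w \<notin> C\<close> show False by blast
    qed
    have sub: "{(a, b). a \<in> ?W \<and> b \<in> ?W \<and> side_adjacent a b} \<subseteq>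
        {(a, b). \<not> good S a \<and> \<not> good S b \<and> side_adjacent a b}" using bad by blast
    obtain n where n: "m = int n" "N < n"
    proof
      show "m = int (nat m)" "N < nat m" using mw(1) by linarith+
    qed
    have "\<exists>s\<in>starts n. chain_exists linked apart S (n div 14) s {}"
      using bad_path_chain[OF rtrancl_mono[OF sub, THEN subsetD, OF mw(4)], of n] bad[OF mw(2)] mw(3) n(1) by auto
    with no_chain n(2) show False by blast
  qed
  define B where "B = {b. good S b \<and> (\<exists>a\<in>A. king_adjacent a b)}"
  have "B \<subseteq> (\<Union>a\<in>A. {fst a - 1..fst a + 1} \<times> {snd a - 1..snd a + 1})"
  proof
    fix b assume "b \<in> B"
    then obtain a where "a \<in> A" "king_adjacent a b" by (auto simp: B_def)
    then show "b \<in> (\<Union>a\<in>A. {fst a - 1..fst a + 1} \<times> {snd a - 1..snd a + 1})"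
      by (intro UN_I[of a]) (auto simp: king_adjacent_def mem_Times_iff abs_le_iff)
  qed
  then have "finite B" by (rule finite_subset) (auto simp: A_def)
  have "C \<subseteq> A \<union> (\<Union>b\<in>B. {d. (b, d) \<in> (good_steps S)\<^sup>*})"
  proof
    fix c assume "c \<in> C"
    then obtain a where "a \<in> A" "(a, c) \<in> R\<^sup>*" by (auto simp: C_def)
    from this(2) show "c \<in> A \<union> (\<Union>b\<in>B. {d. (b, d) \<in> (good_steps S)\<^sup>*})"
    proof (cases rule: converse_rtranclE)
      case base
      then show ?thesis using \<open>a \<in> A\<close> by simp
    next
      case (step b)
      have "(b, c) \<in> (good_steps S)\<^sup>* \<and> good S c"
        using step(2)
      proof induction
        case base
        show ?case using step(1) by (simp add: R_def)
      next
        case (step y z)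
        then show ?case by (auto simp: R_def good_steps_def intro: rtrancl_into_rtrancl)
      qed
      moreover have "b \<in> B" using step(1) \<open>a \<in> A\<close> by (auto simp: R_def B_def)
      ultimately show ?thesis by blast
    qed
  qed
  then have "infinite (\<Union>b\<in>B. {d. (b, d) \<in> (good_steps S)\<^sup>*})"
    using \<open>infinite C\<close> finite_subset[of C "A \<union> (\<Union>b\<in>B. {d. (b, d) \<in> (good_steps S)\<^sup>*})"]
    by (auto simp: A_def)
  then show ?thesis using \<open>finite B\<close> by (auto simp: B_def)
qed

text \<open>Points of touching cells differ by less than \<open>3\<close> in each coordinate, so their squared
distance is less than \<open>18\<close>. A red point at this distance from \<open>x\<close> lies in the octagon of the
cell of \<open>x\<close>: four columns (or rows) away its squared distance would exceed \<open>81/4\<close>, and in a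
corner three columns and three rows away it would exceed \<open>3\<^sup>2 + 3\<^sup>2\<close>.\<close>

lemma mutual_edge:
  assumes xy: "x \<in> P" "y \<in> P" "x \<in> grid_cell (3/2) a" "y \<in> grid_cell (3/2) b"
    and ab: "king_adjacent a b" and good: "good (seeds P P') a"
  shows "(x, y) \<in> parcs (secrecy_digraph P P')"
proof -
  have cell: "3/2 * real_of_int (fst c) \<le> x $ 1" "x $ 1 < 3/2 * (real_of_int (fst c) + 1)"
    "3/2 * real_of_int (snd c) \<le> x $ 2" "x $ 2 < 3/2 * (real_of_int (snd c) + 1)"
    if "x \<in> grid_cell (3/2) c" for x c
    using that grid_cell_iff[of "3/2" x c] by auto
  have d2: "(dist x y)\<^sup>2 = (x $ 1 - y $ 1)\<^sup>2 + (x $ 2 - y $ 2)\<^sup>2" for x y :: "real ^ 2"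
    by (simp add: dist_norm norm_vec_def L2_set_def sum_2 power2_eq_square)
  have "a \<noteq> b" using ab by (simp add: king_adjacent_def)
  then have "x \<noteq> y" using xy by (auto simp: grid_cell_def)
  have close: "(dist x y)\<^sup>2 < 18"
  proof -
    have i: "real_of_int (fst b) \<le> real_of_int (fst a) + 1" "real_of_int (fst a) \<le> real_of_int (fst b) + 1"
      "real_of_int (snd b) \<le> real_of_int (snd a) + 1" "real_of_int (snd a) \<le> real_of_int (snd b) + 1"
    proof -
      have "fst b \<le> fst a + 1" "fst a \<le> fst b + 1" "snd b \<le> snd a + 1" "snd a \<le> snd b + 1"
        using ab unfolding king_adjacent_def by linarith+
      then have "real_of_int (fst b) \<le> real_of_int (fst a + 1)" "real_of_int (fst a) \<le> real_of_int (fst b + 1)"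
        "real_of_int (snd b) \<le> real_of_int (snd a + 1)" "real_of_int (snd a) \<le> real_of_int (snd b + 1)"
        by (simp_all only: of_int_le_iff)
      then show "real_of_int (fst b) \<le> real_of_int (fst a) + 1" "real_of_int (fst a) \<le> real_of_int (fst b) + 1"
        "real_of_int (snd b) \<le> real_of_int (snd a) + 1" "real_of_int (snd a) \<le> real_of_int (snd b) + 1"
        by simp_all
    qed
    have "\<bar>x $ 1 - y $ 1\<bar> < 3" "\<bar>x $ 2 - y $ 2\<bar> < 3"
      using cell[OF xy(3)] cell[OF xy(4)] i by (auto simp: abs_less_iff)
    then have "(x $ 1 - y $ 1)\<^sup>2 < 3\<^sup>2" "(x $ 2 - y $ 2)\<^sup>2 < 3\<^sup>2"
      by (metis abs_ge_zero power2_abs power_strict_mono zero_less_numeral)+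
    then show ?thesis by (simp add: d2)
  qed
  have "P' \<inter> ball x (dist x y) = {}"
  proof (rule ccontr)
    assume "P' \<inter> ball x (dist x y) \<noteq> {}"
    then obtain z where z: "z \<in> P'" "dist x z < dist x y" by auto
    define c where "c = grid_index (3/2) z"
    have zc: "z \<in> grid_cell (3/2) c" unfolding grid_cell_def c_def by (rule CollectI) (rule refl)
    have "z \<in> P' \<inter> grid_cell (3/2) c" using z(1) zc by (rule IntI)
    then have "P' \<inter> grid_cell (3/2) c \<noteq> {}" by (metis empty_iff)
    then have "Red c \<in> seeds P P'" by (simp add: seeds_def)
    have "\<not> near 3 5 a c"
    proof
      assume "near 3 5 a c"
      then have "near 3 5 c a" by (subst near_commute)
      with good have "Red c \<notin> seeds P P'" unfolding good_def by metis
      with \<open>Red c \<in> seeds P P'\<close> show False by simp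
    qed
    have "(dist x z)\<^sup>2 < 18"
      using z(2) close by (smt (verit, best) power_mono zero_le_dist)
    then have sum: "(x $ 1 - z $ 1)\<^sup>2 + (x $ 2 - z $ 2)\<^sup>2 < 18" unfolding d2 .
    have coord: "real_of_int \<bar>k\<bar> \<le> 1 \<or> (3/2 * (real_of_int \<bar>k\<bar> - 1))\<^sup>2 < (u - v)\<^sup>2"
      if "3/2 * real_of_int i \<le> u" "u < 3/2 * (real_of_int i + 1)"
        "3/2 * real_of_int j \<le> v" "v < 3/2 * (real_of_int j + 1)" "k = j - i" for i j k u v
    proof (cases "real_of_int \<bar>k\<bar> \<le> 1")
      case False
      have "3/2 * (real_of_int \<bar>k\<bar> - 1) < \<bar>u - v\<bar>"
        using that(1-4) unfolding that(5) by (auto simp: abs_if)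
      then have "(3/2 * (real_of_int \<bar>k\<bar> - 1))\<^sup>2 < \<bar>u - v\<bar>\<^sup>2"
        using False by (intro power_strict_mono) auto
      then show ?thesis by simp
    qed simp
    define i j where "i = \<bar>fst c - fst a\<bar>" and "j = \<bar>snd c - snd a\<bar>"
    have i: "real_of_int i \<le> 1 \<or> (3/2 * (real_of_int i - 1))\<^sup>2 < (x $ 1 - z $ 1)\<^sup>2"
      and j: "real_of_int j \<le> 1 \<or> (3/2 * (real_of_int j - 1))\<^sup>2 < (x $ 2 - z $ 2)\<^sup>2"
      using coord[of "fst a" "x $ 1" "fst c" "z $ 1"] coord[of "snd a" "x $ 2" "snd c" "z $ 2"]
        cell[OF xy(3)] cell[OF zc] unfolding i_def j_def by blast+
    have sq: "r\<^sup>2 < u\<^sup>2"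
      if "real_of_int t \<le> 1 \<or> (3/2 * (real_of_int t - 1))\<^sup>2 < u\<^sup>2" "0 \<le> r" "1 < real_of_int t"
        "r \<le> 3/2 * (real_of_int t - 1)" for t r u
    proof -
      have "r\<^sup>2 \<le> (3/2 * (real_of_int t - 1))\<^sup>2" using that by (intro power_mono)
      with that show ?thesis by linarith
    qed
    have nonneg: "0 \<le> (x $ 1 - z $ 1)\<^sup>2" "0 \<le> (x $ 2 - z $ 2)\<^sup>2" by simp_all
    have numerals: "(9/2)\<^sup>2 = (81/4 :: real)" "3\<^sup>2 = (9 :: real)" by (simp_all add: power2_eq_square)
    have "i \<le> 3"
    proof (rule ccontr)
      assume "\<not> i \<le> 3"
      then have "4 \<le> real_of_int i" by linarith
      then have "(9/2)\<^sup>2 < (x $ 1 - z $ 1)\<^sup>2" by (intro sq[OF i]) (simp_all add: field_simps)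
      with sum nonneg numerals show False by linarith
    qed
    moreover have "j \<le> 3"
    proof (rule ccontr)
      assume "\<not> j \<le> 3"
      then have "4 \<le> real_of_int j" by linarith
      then have "(9/2)\<^sup>2 < (x $ 2 - z $ 2)\<^sup>2" by (intro sq[OF j]) (simp_all add: field_simps)
      with sum nonneg numerals show False by linarith
    qed
    ultimately have "i = 3" "j = 3" using \<open>\<not> near 3 5 a c\<close> unfolding near_def i_def j_def by linarith+
    then have "3\<^sup>2 < (x $ 1 - z $ 1)\<^sup>2" "3\<^sup>2 < (x $ 2 - z $ 2)\<^sup>2"
      by (intro sq[OF i] sq[OF j]; simp)+
    with sum numerals show False by linarith
  qed
  with xy \<open>x \<noteq> y\<close> show ?thesis by (simp add: secrecy_digraph_def)
qed

lemma infinite_mutual_cluster: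
  assumes "good (seeds P P') c" "infinite {d. (c, d) \<in> (good_steps (seeds P P'))\<^sup>*}"
  shows "\<exists>x\<in>P. infinite {y. (x, y) \<in> (parcs (bidirectional_secrecy_graph P P'))\<^sup>*}"
proof -
  let ?S = "seeds P P'" and ?E = "parcs (bidirectional_secrecy_graph P P')"
  have "\<exists>x. x \<in> P \<and> x \<in> grid_cell (3/2) d" if "good ?S d" for d
    using that by (auto simp: good_def seeds_def)
  then obtain p where p: "\<And>d. good ?S d \<Longrightarrow> p d \<in> P \<and> p d \<in> grid_cell (3/2) d" by metis
  have reach: "good ?S d \<and> (p c, p d) \<in> ?E\<^sup>*" if "(c, d) \<in> (good_steps ?S)\<^sup>*" for d
    using that
  proof induction
    case (step d e)
    then have de: "good ?S d" "good ?S e" "king_adjacent d e" by (auto simp: good_steps_def)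
    have ed: "king_adjacent e d" using de(3) by (auto simp: king_adjacent_def)
    have "(p d, p e) \<in> ?E"
      using mutual_edge[of "p d" P "p e" d e P'] mutual_edge[of "p e" P "p d" e d P'] p de ed
      by (simp add: bidirectional_secrecy_graph_def)
    with step.IH de show ?case by (auto intro: rtrancl_into_rtrancl)
  qed (use assms in auto)
  have "inj_on p {d. (c, d) \<in> (good_steps ?S)\<^sup>*}"
    using reach p by (intro inj_onI) (metis (mono_tags, lifting) grid_cell_def mem_Collect_eq)
  then have "infinite (p ` {d. (c, d) \<in> (good_steps ?S)\<^sup>*})" using assms(2) finite_imageD by blast
  moreover have "p ` {d. (c, d) \<in> (good_steps ?S)\<^sup>*} \<subseteq> {y. (p c, y) \<in> ?E\<^sup>*}" using reach by auto
  ultimately show ?thesis using p assms(1) finite_subset by blast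
qed

text \<open>From the quadratic lower bound \<open>41/32\<close> for \<open>exp (1/4)\<close>, raised to the ninth power.\<close>

lemma exp_minus_nine_quarters: "exp (- 9/4 :: real) \<le> 0.1075"
proof -
  have "(41/32) ^ 9 \<le> exp (1/4 :: real) ^ 9"
    using exp_lower_Taylor_quadratic[of "1/4 :: real"] by (intro power_mono) (simp_all add: power2_eq_square)
  also have "exp (1/4 :: real) ^ 9 = exp (9/4)" by (simp flip: exp_of_nat_mult)
  finally have "1 / 0.1075 \<le> exp (9/4 :: real)" by (simp add: power_divide)
  then have "1 \<le> 0.1075 * exp (9/4 :: real)" by simp
  then have "exp (- 9/4 :: real) * 1 \<le> exp (- 9/4) * (0.1075 * exp (9/4))" by (intro mult_left_mono) simp_all
  also have "\<dots> = 0.1075" by (simp add: exp_minus field_simps)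
  finally show ?thesis by simp
qed

text \<open>Smooths \<open>m div 14\<close> into a geometric sequence in \<open>m\<close>: \<open>0.82 \<le> 0.99 ^ 14\<close> and \<open>1 \<le> 2 *
0.99 ^ 13\<close>.\<close>

lemma chain_length_decay: "(0.82 :: real) ^ (m div 14) \<le> 2 * 0.99 ^ m"
proof -
  have "(0.82 :: real) ^ (m div 14) \<le> (0.99 ^ 14) ^ (m div 14)" by (intro power_mono) (simp_all add: power_divide)
  also have "\<dots> = 0.99 ^ (14 * (m div 14))" by (simp add: power_mult)
  also have "\<dots> \<le> 2 * (0.99 ^ (m mod 14) * 0.99 ^ (14 * (m div 14)))"
  proof -
    have "1/2 \<le> (0.99 :: real) ^ 13" by (simp add: power_divide)
    also have "\<dots> \<le> 0.99 ^ (m mod 14)" by (rule power_decreasing) simp_all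
    finally have "1 \<le> 2 * (0.99 :: real) ^ (m mod 14)" by linarith
    then have "1 * 0.99 ^ (14 * (m div 14)) \<le> (2 * 0.99 ^ (m mod 14)) * (0.99 :: real) ^ (14 * (m div 14))"
      by (rule mult_right_mono) simp
    then show ?thesis by simp
  qed
  also have "(0.99 :: real) ^ (m mod 14) * 0.99 ^ (14 * (m div 14)) = 0.99 ^ m"
    by (simp flip: power_add)
  finally show ?thesis .
qed

lemma finite_starts: "finite (starts m)" and card_starts: "card (starts m) \<le> 50"
proof -
  have near: "{d. near 3 5 (int m, 0) d} \<subseteq> {int m - 3..int m + 3} \<times> {-3..3}"
  proof
    fix d assume "d \<in> {d. near 3 5 (int m, 0) d}"
    then have "\<bar>fst d - int m\<bar> \<le> 3" "\<bar>snd d\<bar> \<le> 3" by (simp_all add: near_def)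
    then show "d \<in> {int m - 3..int m + 3} \<times> {-3..3}" by (auto simp: mem_Times_iff abs_le_iff)
  qed
  then have fin: "finite {d. near 3 5 (int m, 0) d}" by (rule finite_subset) simp
  then show "finite (starts m)" by (simp add: starts_def)
  have "card {d. near 3 5 (int m, 0) d} \<le> card ({int m - 3..int m + 3} \<times> {-3..3 :: int})"
    by (rule card_mono[OF _ near]) simp
  then have "card {d. near 3 5 (int m, 0) d} \<le> 49" by (simp add: card_cartesian_product)
  then have "card (Red ` {d. near 3 5 (int m, 0) d}) \<le> 49" using card_image_le[OF fin, of Red] by linarith
  then show "card (starts m) \<le> 50"
    unfolding starts_def using card_insert_le_m1[of 50 "Red ` {d. near 3 5 (int m, 0) d}"] by simp
qed

text \<open>The events \<open>B m\<close> that a long chain starts next to \<open>(m, 0)\<close> have summable probabilities,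
so for some \<open>N\<close>, with positive probability, none of those with \<open>m > N\<close> occurs. Then the
cluster of the segment of length \<open>N\<close> cannot be finite.\<close>

lemma mutual_cluster_positive:
  fixes P P' :: "'w \<Rightarrow> (real ^ 2) set"
  assumes proc: "independent_poisson_processes M 1 P l P'" and l: "0 < l" "l < 0.002"
  shows "\<exists>A\<in>sets M. 0 < measure M A \<and>
    (\<forall>\<omega>\<in>A. \<exists>x\<in>P \<omega>. infinite {y. (x, y) \<in> (parcs (bidirectional_secrecy_graph (P \<omega>) (P' \<omega>)))\<^sup>*})"
proof -
  interpret prob_space M using proc by (simp add: independent_poisson_processes_def poisson_process_def)
  define S where "S \<omega> = seeds (P \<omega>) (P' \<omega>)" for \<omega>
  define r where "r = 1 - exp (- (9/4 * l))"
  have r: "0 \<le> r" "r \<le> 0.0045"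
  proof -
    show "0 \<le> r" using l by (simp add: r_def)
    have "1 + - (9/4 * l) \<le> exp (- (9/4 * l))" by (rule exp_ge_add_one_self)
    then have "r \<le> 9/4 * l" by (simp add: r_def)
    also have "\<dots> \<le> 0.0045" using l by simp
    finally show "r \<le> 0.0045" .
  qed
  define w where "w = weight (exp (- 9/4)) r"
  have w: "0 \<le> w s" for s using r by (cases s) (simp_all add: w_def)
  have chain: "{\<omega> \<in> space M. chain_exists linked apart (S \<omega>) k s {}} \<in> events \<and>
      prob {\<omega> \<in> space M. chain_exists linked apart (S \<omega>) k s {}} \<le> (\<Prod>s\<in>{}. w s) * (0.82 ^ k * weight 1 5 s)" for k s
  proof (rule chain_exists_prob_le[where q = w and \<phi> = "weight 1 5"])
    show "1 \<le> weight 1 5 s" for s by (cases s) simp_all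
    show "(\<Sum>t | linked s t. w t * (\<Sum>u | linked t u \<and> apart s u. w u * weight 1 5 u)) \<le> 0.82 * weight 1 5 s" for s
      unfolding w_def using exp_minus_nine_quarters r by (intro two_step_bound) simp_all
  qed (use seeds_prob[OF proc] w in \<open>auto simp: S_def w_def r_def finite_linked\<close>)
  define B where "B m = (\<Union>s\<in>starts m. {\<omega> \<in> space M. chain_exists linked apart (S \<omega>) (m div 14) s {}})" for m
  have B: "B m \<in> events" for m unfolding B_def using chain finite_starts by (intro sets.finite_UN) auto
  have prob_B: "prob (B m) \<le> 500 * 0.99 ^ m" for m
  proof -
    have "prob (B m) \<le> (\<Sum>s\<in>starts m. prob {\<omega> \<in> space M. chain_exists linked apart (S \<omega>) (m div 14) s {}})"
      unfolding B_def using chain by (intro finite_measure_subadditive_finite finite_starts) auto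
    also have "\<dots> \<le> (\<Sum>s\<in>starts m. 0.82 ^ (m div 14) * 5)"
    proof (rule sum_mono)
      fix s
      have "weight 1 5 s \<le> 5" by (cases s) simp_all
      then have "0.82 ^ (m div 14) * weight 1 5 s \<le> 0.82 ^ (m div 14) * 5" by (rule mult_left_mono) simp
      with chain[of "m div 14" s] show "prob {\<omega> \<in> space M. chain_exists linked apart (S \<omega>) (m div 14) s {}} \<le> 0.82 ^ (m div 14) * 5"
        by (simp only: prod.empty mult_1) linarith
    qed
    also have "\<dots> = real (card (starts m)) * (0.82 ^ (m div 14) * 5)" by simp
    also have "\<dots> \<le> 50 * (2 * 0.99 ^ m * 5)"
      using card_starts[of m] chain_length_decay[of m] by (intro mult_mono) auto
    finally show ?thesis by simp
  qed
  obtain N where N: "(0.99 :: real) ^ N < 1 / 50000" using real_arch_pow_inv[of "1 / 50000" "0.99 :: real"] by auto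
  have sums: "(\<lambda>i. 500 * 0.99 ^ (i + Suc N)) sums (50000 * (0.99 :: real) ^ Suc N)"
  proof -
    have "(\<lambda>i. (500 * 0.99 ^ Suc N) * (0.99 :: real) ^ i) sums ((500 * 0.99 ^ Suc N) * (1 / (1 - 0.99)))"
      by (intro sums_mult geometric_sums) simp
    then show ?thesis by (simp add: power_add mult_ac)
  qed
  have summ: "summable (\<lambda>i. prob (B (i + Suc N)))"
  proof (rule summable_comparison_test'[OF sums_summable[OF sums]])
    show "norm (prob (B (i + Suc N))) \<le> 500 * 0.99 ^ (i + Suc N)" if "0 \<le> i" for i
      using prob_B[of "i + Suc N"] by (simp only: real_norm_def abs_of_nonneg[OF measure_nonneg])
  qed
  have "prob (\<Union>i. B (i + Suc N)) \<le> (\<Sum>i. prob (B (i + Suc N)))"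
    using B summ by (intro finite_measure_subadditive_countably) auto
  also have "\<dots> \<le> (\<Sum>i. 500 * 0.99 ^ (i + Suc N))"
    by (intro suminf_le prob_B summ sums_summable[OF sums])
  also have "\<dots> = 50000 * 0.99 ^ Suc N" using sums by (rule sums_unique[symmetric])
  also have "\<dots> < 1" using N by simp
  finally have lt1: "prob (\<Union>i. B (i + Suc N)) < 1" .
  define A where "A = space M - (\<Union>i. B (i + Suc N))"
  have "(\<Union>i. B (i + Suc N)) \<in> events" using B by auto
  then have "A \<in> events" "0 < prob A" using lt1 prob_compl unfolding A_def by auto
  moreover have "\<exists>x\<in>P \<omega>. infinite {y. (x, y) \<in> (parcs (bidirectional_secrecy_graph (P \<omega>) (P' \<omega>)))\<^sup>*}"
    if "\<omega> \<in> A" for \<omega>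
  proof -
    have "\<not> chain_exists linked apart (S \<omega>) (m div 14) s {}" if m: "N < m" "s \<in> starts m" for m s
    proof
      assume "chain_exists linked apart (S \<omega>) (m div 14) s {}"
      then have "\<omega> \<in> B m" using m(2) \<open>\<omega> \<in> A\<close> by (auto simp: B_def A_def)
      moreover have "m = (m - Suc N) + Suc N" using m(1) by simp
      ultimately have "\<omega> \<in> (\<Union>i. B (i + Suc N))" by (metis UNIV_I UN_I)
      with \<open>\<omega> \<in> A\<close> show False by (simp add: A_def)
    qed
    from infinite_cluster_or_chain[OF this] show ?thesis
      using infinite_mutual_cluster unfolding S_def by blast
  qed
  ultimately show ?thesis by blast
qed

section \<open>Components, trees and reachability\<close>

lemma reachable_iff_rtrancl:
  assumes "pair_wf_digraph G" "u \<in> pverts G"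
  shows "u \<rightarrow>\<^sup>*\<^bsub>with_proj G\<^esub> v \<longleftrightarrow> (u, v) \<in> (parcs G)\<^sup>*"
proof
  assume "u \<rightarrow>\<^sup>*\<^bsub>with_proj G\<^esub> v"
  then show "(u, v) \<in> (parcs G)\<^sup>*" using reachable_rtranclI[of "with_proj G" u v] by simp
next
  interpret pair_wf_digraph G by fact
  assume "(u, v) \<in> (parcs G)\<^sup>*"
  then show "u \<rightarrow>\<^sup>*\<^bsub>with_proj G\<^esub> v"
    by induction (use assms(2) in \<open>auto intro: reachable_adj_trans\<close>)
qed

text \<open>The strong components are the classes of mutual reachability.\<close>

lemma has_infinite_component_iff:
  assumes "pair_wf_digraph G"
  shows "has_infinite_component G \<longleftrightarrow>
    (\<exists>u\<in>pverts G. infinite {v. (u, v) \<in> (parcs G)\<^sup>* \<and> (v, u) \<in> (parcs G)\<^sup>*})"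
proof -
  interpret pair_wf_digraph G by fact
  have in_verts: "v \<in> pverts G" if "(u, v) \<in> (parcs G)\<^sup>*" "u \<in> pverts G" for u v
    using that by induction (auto dest: in_arcsD2)
  have "has_infinite_component G \<longleftrightarrow> (\<exists>S\<in>sccs_verts. infinite S)"
    unfolding has_infinite_component_def sccs_verts_conv by auto
  also have "\<dots> \<longleftrightarrow> (\<exists>u\<in>pverts G. infinite (scc_of u))"
    unfolding sccs_verts_conv_scc_of by auto
  also have "scc_of u = {v. (u, v) \<in> (parcs G)\<^sup>* \<and> (v, u) \<in> (parcs G)\<^sup>*}" if "u \<in> pverts G" for u
    using that in_verts reachable_iff_rtrancl[OF assms] unfolding scc_of_def by blast
  then have "(\<exists>u\<in>pverts G. infinite (scc_of u)) \<longleftrightarrow>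
      (\<exists>u\<in>pverts G. infinite {v. (u, v) \<in> (parcs G)\<^sup>* \<and> (v, u) \<in> (parcs G)\<^sup>*})" by auto
  finally show ?thesis .
qed

lemma infinite_strongly_connected_iff:
  assumes "pair_wf_digraph G"
  shows "(\<exists>H. subgraph H (with_proj G) \<and> strongly_connected H \<and> infinite (verts H)) \<longleftrightarrow>
    (\<exists>u\<in>pverts G. infinite {v. (u, v) \<in> (parcs G)\<^sup>* \<and> (v, u) \<in> (parcs G)\<^sup>*})"
proof
  assume "\<exists>H. subgraph H (with_proj G) \<and> strongly_connected H \<and> infinite (verts H)"
  then obtain H where H: "subgraph H (with_proj G)" "strongly_connected H" "infinite (verts H)" by blast
  have ends: "arcs_ends H \<subseteq> parcs G" using arcs_ends_mono[OF H(1)] by simp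
  have reach: "(u, v) \<in> (parcs G)\<^sup>*" if "u \<in> verts H" "v \<in> verts H" for u v
  proof -
    have "(u, v) \<in> (arcs_ends H)\<^sup>*" using H(2) that by (auto simp: strongly_connected_def intro: reachable_rtranclI)
    then show ?thesis using rtrancl_mono[OF ends] by blast
  qed
  obtain u where u: "u \<in> verts H" using H(3) by fastforce
  then have "verts H \<subseteq> {v. (u, v) \<in> (parcs G)\<^sup>* \<and> (v, u) \<in> (parcs G)\<^sup>*}" using reach by blast
  moreover have "u \<in> pverts G" using u subgraph_imp_subverts[OF H(1)] by auto
  ultimately show "\<exists>u\<in>pverts G. infinite {v. (u, v) \<in> (parcs G)\<^sup>* \<and> (v, u) \<in> (parcs G)\<^sup>*}"
    using H(3) finite_subset by blast
next
  assume "\<exists>u\<in>pverts G. infinite {v. (u, v) \<in> (parcs G)\<^sup>* \<and> (v, u) \<in> (parcs G)\<^sup>*}"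
  then have "has_infinite_component G" using has_infinite_component_iff[OF assms] by blast
  then show "\<exists>H. subgraph H (with_proj G) \<and> strongly_connected H \<and> infinite (verts H)"
    unfolding has_infinite_component_def pre_digraph.sccs_def by (auto dest: induced_imp_subgraph)
qed

lemma pair_sym_digraph_mk_symmetric:
  assumes "pair_wf_digraph t"
  shows "pair_sym_digraph (mk_symmetric (with_proj t))"
proof -
  interpret t: pair_wf_digraph t by fact
  show ?thesis
    by (intro pair_sym_digraph.intro t.wellformed_mk_symmetric pair_sym_digraph_axioms.intro
        symmetric_mk_symmetric)
qed

lemma awalk_avoiding_rtrancl:
  assumes "pair_wf_digraph G" and "pre_digraph.awalk (with_proj G) u p v"
    and "x \<notin> set (pawalk_verts u p)"
  shows "(u, v) \<in> {(a, b). (a, b) \<in> parcs G \<and> a \<noteq> x \<and> b \<noteq> x}\<^sup>*"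
proof -
  interpret pair_wf_digraph G by fact
  show ?thesis
    using assms(2,3)
  proof (induction p arbitrary: u)
    case Nil
    then show ?case by (simp add: awalk_Nil_iff)
  next
    case (Cons e p)
    obtain a b where e: "e = (a, b)" by (cases e)
    from Cons.prems have "a = u" "(u, b) \<in> parcs G" "awalk b p v" by (auto simp: awalk_Cons_iff e)
    moreover have "b \<noteq> x" "u \<noteq> x"
      using Cons.prems \<open>a = u\<close> hd_in_awalk_verts(1)[OF \<open>awalk b p v\<close>] by (auto simp: e)
    moreover have "(b, v) \<in> {(a, b). (a, b) \<in> parcs G \<and> a \<noteq> x \<and> b \<noteq> x}\<^sup>*"
      using Cons.IH[OF \<open>awalk b p v\<close>] Cons.prems by (simp add: e)
    ultimately show ?case by (auto intro: converse_rtrancl_into_rtrancl)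
  qed
qed

text \<open>In a tree the ends of an edge are not joined without this edge: a path joining them
would have length at least 2 and would close up to a cycle of length at least 3.\<close>

lemma underlying_tree_no_detour:
  assumes "wf_digraph T" and tree: "underlying_tree T"
    and uv: "(u, v) \<in> parcs (mk_symmetric T)" "u \<noteq> v"
  shows "(v, u) \<notin> (parcs (mk_symmetric T) - {(u, v), (v, u)})\<^sup>*"
proof
  interpret T: wf_digraph T by fact
  define Q where "Q = mk_symmetric T"
  define Q' where "Q' = \<lparr>pverts = pverts Q, parcs = parcs Q - {(u, v), (v, u)}\<rparr>"
  interpret Q: pair_wf_digraph Q unfolding Q_def by (rule T.wellformed_mk_symmetric)
  interpret Q': pair_wf_digraph Q'
    by unfold_locales (use Q.arc_fst_in_verts Q.arc_snd_in_verts in \<open>auto simp: Q'_def\<close>)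
  assume "(v, u) \<in> (parcs (mk_symmetric T) - {(u, v), (v, u)})\<^sup>*"
  then have "v \<rightarrow>\<^sup>*\<^bsub>with_proj Q'\<^esub> u"
    using reachable_iff_rtrancl[OF Q'.pair_wf_digraph_axioms, of v u] uv Q.in_arcsD2[of u v]
    by (simp add: Q'_def Q_def)
  then obtain p where p: "Q'.apath v p u" using Q'.reachable_apath by blast
  then have walk: "Q'.awalk v p u" and dist: "distinct (pawalk_verts v p)" by (auto simp: Q'.apath_def)
  have sub: "set p \<subseteq> parcs Q - {(u, v), (v, u)}" proof -
    have "set p \<subseteq> parcs Q'" using walk by (simp add: Q'.awalk_def)
    then show ?thesis by (simp add: Q'_def)
  qed
  have cas: "pcas v p u" using walk by (auto simp: Q'.awalk_def)
  have "2 \<le> length p"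
  proof (cases p)
    case Nil
    then show ?thesis using cas uv(2) by simp
  next
    case (Cons e p')
    have "p' \<noteq> []"
    proof
      assume "p' = []"
      then have "e = (v, u)" using cas Cons by (cases e) auto
      then show False using sub Cons by simp
    qed
    then show ?thesis using Cons by (cases p') auto
  qed
  have Qwalk: "Q.awalk v p u" proof -
    have "v \<in> pverts Q" using Q.in_arcsD2[of u v] uv by (simp add: Q_def)
    then show ?thesis using sub cas by (auto simp: Q.awalk_def)
  qed
  have "Q.awalk v (p @ [(u, v)]) v"
  proof -
    have "(u, v) \<in> parcs Q" using uv by (simp add: Q_def)
    then show ?thesis using Qwalk Q.in_arcsD2[of u v] by (simp add: Q.awalk_simps)
  qed
  moreover have "distinct (tl (pawalk_verts v (p @ [(u, v)])))"
  proof -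
    have *: "pawalk_verts v (p @ [(u, v)]) = pawalk_verts v p @ [v]"
      using Q.awalk_verts_append[OF \<open>Q.awalk v (p @ [(u, v)]) v\<close>] Q.awlast_of_awalk[OF Qwalk] by simp
    have "hd (pawalk_verts v p) = v" using Q.awhd_of_awalk[OF Qwalk] .
    then show ?thesis using dist unfolding * by (cases "pawalk_verts v p") auto
  qed
  ultimately have "Q.cycle (p @ [(u, v)])" unfolding Q.cycle_def by blast
  moreover have "3 \<le> length (p @ [(u, v)])" using \<open>2 \<le> length p\<close> by simp
  ultimately show False using tree unfolding underlying_tree_def Q_def by blast
qed

text \<open>Every path from the root runs along the arcs. Suppose it used an arc \<open>(b, a)\<close>
backwards, from \<open>a\<close> to \<open>b\<close>. Its initial part avoids \<open>b\<close>, while the path from the root that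
ends with \<open>(b, a)\<close> reaches \<open>b\<close> avoiding \<open>a\<close>. Together they form a detour from \<open>b\<close> to \<open>a\<close>
that does not use the edge between them.\<close>

lemma out_tree_reachable:
  assumes t: "pair_wf_digraph t" and tree: "out_tree r (with_proj t)" and v: "v \<in> pverts t"
  shows "(r, v) \<in> (parcs t)\<^sup>*"
proof -
  interpret t: pair_wf_digraph t by fact
  define Q where "Q = mk_symmetric (with_proj t)"
  have arcsQ: "parcs Q = parcs t \<union> (parcs t)\<inverse>" by (auto simp: Q_def parcs_mk_symmetric)
  interpret Q: pair_sym_digraph Q
    unfolding Q_def by (rule pair_sym_digraph_mk_symmetric) (rule t.pair_wf_digraph_axioms)
  have root: "r \<in> pverts t" and ut: "underlying_tree (with_proj t)"
    and all: "\<forall>e\<in>parcs t. \<exists>p. Q.apath r (p @ [(fst e, snd e)]) (snd e)"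
    using tree unfolding out_tree_def Q_def by simp_all
  have away: "\<exists>p. Q.apath r (p @ [(a, b)]) b" if "(a, b) \<in> parcs t" for a b
    using bspec[OF all that] by simp
  have split: "Q.awalk r p1 a" "b \<notin> set (pawalk_verts r p1)" "a \<noteq> b"
    if "Q.apath r (p1 @ (a, b) # p2) w" for p1 a b p2 w
  proof -
    from that have *: "Q.apath r p1 (last (pawalk_verts r p1))"
        "Q.apath (last (pawalk_verts r p1)) ((a, b) # p2) w"
        "set (pawalk_verts r p1) \<inter> set (pawalk_verts b p2) = {}"
      by (simp_all add: Q.apath_append_iff)
    from *(2) have a: "a = last (pawalk_verts r p1)" "Q.apath b p2 w" "a \<notin> set (pawalk_verts b p2)"
      by (auto simp: Q.apath_Cons_iff)
    have "b \<in> set (pawalk_verts b p2)" by (rule Q.hd_in_awalk_verts(2)[OF a(2)])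
    then show "Q.awalk r p1 a" "b \<notin> set (pawalk_verts r p1)" "a \<noteq> b"
      using * a by (auto simp: Q.apath_def)
  qed
  have directed: "set p \<subseteq> parcs t" if p: "Q.apath r p w" for p w
  proof
    fix e assume "e \<in> set p"
    obtain a b where e: "e = (a, b)" by (cases e)
    obtain p1 p2 where p12: "p = p1 @ (a, b) # p2" using \<open>e \<in> set p\<close> e by (auto dest: split_list)
    show "e \<in> parcs t"
    proof (rule ccontr)
      assume "e \<notin> parcs t"
      have ab: "(a, b) \<in> parcs Q" using p p12 by (auto simp: Q.apath_def Q.awalk_def)
      with \<open>e \<notin> parcs t\<close> e have "(b, a) \<in> parcs t" by (auto simp: arcsQ)
      then obtain q where q: "Q.apath r (q @ [(b, a)]) a" using away by blast
      have p1: "Q.awalk r p1 a" "b \<notin> set (pawalk_verts r p1)" and ne: "a \<noteq> b"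
        using split[OF p[unfolded p12]] by simp_all
      have q1: "Q.awalk r q b" "a \<notin> set (pawalk_verts r q)"
        using split[OF q] by simp_all
      let ?R = "parcs Q - {(a, b), (b, a)}"
      have symR: "sym ?R" using Q.arcs_symmetric by (auto simp: sym_def)
      have "(r, a) \<in> ?R\<^sup>*"
        using awalk_avoiding_rtrancl[OF Q.pair_wf_digraph_axioms p1]
        by (rule rtrancl_mono[THEN subsetD, rotated]) auto
      moreover have "(r, b) \<in> ?R\<^sup>*"
        using awalk_avoiding_rtrancl[OF Q.pair_wf_digraph_axioms q1]
        by (rule rtrancl_mono[THEN subsetD, rotated]) auto
      ultimately have "(b, a) \<in> ?R\<^sup>*" using sym_rtrancl[OF symR] by (meson rtrancl_trans symE)
      then show False
        using underlying_tree_no_detour[OF t.wf_digraph_axioms ut] ab ne unfolding Q_def by blast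
    qed
  qed
  have "r \<rightarrow>\<^sup>*\<^bsub>with_proj Q\<^esub> v"
    using ut root v unfolding underlying_tree_def Digraph_Component.connected_def strongly_connected_def Q_def by simp
  then obtain p where p: "Q.apath r p v" using Q.reachable_apath by blast
  from directed[OF p] have "t.awalk r p v" using p root by (auto simp: Q.apath_def Q.awalk_def t.awalk_def)
  then show ?thesis using t.reachable_awalkI reachable_iff_rtrancl[OF t root] by blast
qed


text \<open>Reversal exchanges out-trees and in-trees, so only out-trees have to be studied.\<close>

definition reverse_arcs :: "'a pair_pre_digraph \<Rightarrow> 'a pair_pre_digraph" where
  "reverse_arcs G = \<lparr>pverts = pverts G, parcs = (parcs G)\<inverse>\<rparr>"

lemma reverse_arcs_simps [simp]:
  "pverts (reverse_arcs G) = pverts G" "parcs (reverse_arcs G) = (parcs G)\<inverse>"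
  "reverse_arcs (reverse_arcs G) = G"
  by (simp_all add: reverse_arcs_def)

lemma pair_wf_digraph_reverse_arcs: "pair_wf_digraph G \<Longrightarrow> pair_wf_digraph (reverse_arcs G)"
  by (auto simp: pair_wf_digraph_def)

lemma mk_symmetric_reverse_arcs:
  "mk_symmetric (with_proj (reverse_arcs G)) = mk_symmetric (with_proj G)"
  by (auto simp: mk_symmetric_def)

lemma ball_converse: "(\<forall>e\<in>A\<inverse>. X (fst e) (snd e)) \<longleftrightarrow> (\<forall>e\<in>A. X (snd e) (fst e))"
  unfolding Ball_def split_paired_All by (simp, blast)

lemma in_tree_iff_out_tree_reverse:
  assumes "pair_wf_digraph t"
  shows "in_tree r (with_proj t) \<longleftrightarrow> out_tree r (with_proj (reverse_arcs t))"
proof -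
  interpret t: pair_wf_digraph t by fact
  define Q where "Q = mk_symmetric (with_proj t)"
  interpret Q: pair_sym_digraph Q
    unfolding Q_def by (rule pair_sym_digraph_mk_symmetric) (rule t.pair_wf_digraph_axioms)
  have flip: "(\<exists>p. Q.apath a ((a, b) # p) r) \<longleftrightarrow> (\<exists>p. Q.apath r (p @ [(b, a)]) a)" for a b
  proof
    assume "\<exists>p. Q.apath a ((a, b) # p) r"
    then obtain p where "Q.apath a ((a, b) # p) r" ..
    then have "Q.apath r (rev_path p @ [(b, a)]) a"
      using Q.apath_rev_path[of r "(a, b) # p" a] by simp
    then show "\<exists>p. Q.apath r (p @ [(b, a)]) a" ..
  next
    assume "\<exists>p. Q.apath r (p @ [(b, a)]) a"
    then obtain p where "Q.apath r (p @ [(b, a)]) a" ..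
    then have "Q.apath a ((a, b) # rev_path p) r"
      using Q.apath_rev_path[of a "p @ [(b, a)]" r] by simp
    then show "\<exists>p. Q.apath a ((a, b) # p) r" ..
  qed
  have "(\<forall>e\<in>parcs t. \<exists>p. Q.apath (fst e) ((fst e, snd e) # p) r) \<longleftrightarrow>
      (\<forall>e\<in>(parcs t)\<inverse>. \<exists>p. Q.apath r (p @ [(fst e, snd e)]) (snd e))"
    unfolding flip ball_converse[of "parcs t" "\<lambda>a b. \<exists>p. Q.apath r (p @ [(a, b)]) b"] ..
  moreover have "underlying_tree (with_proj (reverse_arcs t)) \<longleftrightarrow> underlying_tree (with_proj t)"
    unfolding underlying_tree_def Digraph_Component.connected_def mk_symmetric_reverse_arcs by simp
  ultimately show ?thesis
    unfolding in_tree_def out_tree_def mk_symmetric_reverse_arcs Q_def by simp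
qed

lemma pcas_consecutive: "pcas u p v \<Longrightarrow> Suc i < length p \<Longrightarrow> fst (p ! Suc i) = snd (p ! i)"
proof (induction p arbitrary: u i)
  case (Cons e p)
  then show ?case by (cases i; cases p) auto
qed simp

lemma pcas_last: "pcas u p v \<Longrightarrow> p \<noteq> [] \<Longrightarrow> snd (last p) = v"
  by (induction p arbitrary: u) (auto split: if_splits)

text \<open>Give every vertex other than \<open>r\<close> a parent \<open>f v\<close> that is one step closer to \<open>r\<close>. On a
cycle of the underlying graph both neighbours of a vertex at greatest distance from \<open>r\<close>
would be its parent, which is impossible if the cycle has length at least 3.\<close>

lemma breadth_first_out_tree:
  assumes G: "pair_wf_digraph G" and r: "r \<in> pverts G"
  shows "\<exists>t. pair_wf_digraph t \<and> pverts t = {v. (r, v) \<in> (parcs G)\<^sup>*} \<and> parcs t \<subseteq> parcs G \<and>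
    out_tree r (with_proj t)"
proof -
  define V where "V = {v. (r, v) \<in> (parcs G)\<^sup>*}"
  define d where "d v = (LEAST n. (r, v) \<in> parcs G ^^ n)" for v
  have d: "(r, v) \<in> parcs G ^^ d v" if "v \<in> V" for v
  proof -
    from that obtain n where "(r, v) \<in> parcs G ^^ n" by (auto simp: V_def rtrancl_power)
    then show ?thesis unfolding d_def by (rule LeastI)
  qed
  have d_le: "d v \<le> n" if "(r, v) \<in> parcs G ^^ n" for v n
    using that unfolding d_def by (rule Least_le)
  have "\<exists>y. y \<in> V \<and> (y, v) \<in> parcs G \<and> d v = Suc (d y)" if v: "v \<in> V" "v \<noteq> r" for v
  proof -
    obtain n where n: "d v = Suc n" using d[OF v(1)] v(2) by (cases "d v") auto
    with d[OF v(1)] obtain y where y: "(r, y) \<in> parcs G ^^ n" "(y, v) \<in> parcs G" by auto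
    then have "y \<in> V" by (auto simp: V_def rtrancl_power)
    moreover have "d v \<le> Suc (d y)" using d_le[of v "Suc (d y)"] d[OF \<open>y \<in> V\<close>] y(2) by auto
    ultimately show ?thesis using d_le[OF y(1)] n y(2) by (intro exI[of _ y]) auto
  qed
  then obtain f where f: "\<And>v. v \<in> V \<Longrightarrow> v \<noteq> r \<Longrightarrow> f v \<in> V \<and> (f v, v) \<in> parcs G \<and> d v = Suc (d (f v))"
    by metis
  have rV: "r \<in> V" by (simp add: V_def)
  define t where "t = \<lparr>pverts = V, parcs = {(f v, v) | v. v \<in> V \<and> v \<noteq> r}\<rparr>"
  interpret t: pair_wf_digraph t by unfold_locales (use f in \<open>auto simp: t_def\<close>)
  define Q where "Q = mk_symmetric (with_proj t)"
  interpret Q: pair_sym_digraph Q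
    unfolding Q_def by (rule pair_sym_digraph_mk_symmetric) (rule t.pair_wf_digraph_axioms)
  have vertsQ: "pverts Q = V" by (simp add: Q_def t_def)
  have arcsQ: "(a, b) \<in> parcs Q \<longleftrightarrow> (b \<in> V \<and> b \<noteq> r \<and> a = f b) \<or> (a \<in> V \<and> a \<noteq> r \<and> b = f a)" for a b
    unfolding Q_def parcs_mk_symmetric by (auto simp: t_def)
  have path: "\<exists>p. Q.apath r p v \<and> (\<forall>x\<in>set (pawalk_verts r p). d x \<le> d v) \<and> (v \<noteq> r \<longrightarrow> (\<exists>p'. p = p' @ [(f v, v)]))"
    if "v \<in> V" for v
    using that
  proof (induction "d v" arbitrary: v rule: less_induct)
    case less
    show ?case
    proof (cases "v = r")
      case True
      then show ?thesis using rV by (intro exI[of _ "[]"]) (simp add: Q.apath_Nil_iff vertsQ)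
    next
      case False
      note fv = f[OF less.prems False]
      then obtain p where p: "Q.apath r p (f v)" "\<forall>x\<in>set (pawalk_verts r p). d x \<le> d (f v)"
        using less.hyps[of "f v"] by auto
      have walk: "Q.awalk r p (f v)" using p(1) by (simp add: Q.apath_def)
      have arc: "(f v, v) \<in> parcs Q" using less.prems False by (simp add: arcsQ)
      have walk': "Q.awalk r (p @ [(f v, v)]) v"
        using walk arc less.prems by (simp add: Q.awalk_simps vertsQ)
      have verts: "pawalk_verts r (p @ [(f v, v)]) = pawalk_verts r p @ [v]"
        using Q.awalk_verts_append[OF walk'] Q.awlast_of_awalk[OF walk] by simp
      have "v \<notin> set (pawalk_verts r p)" using p(2) fv by fastforce
      then have "Q.apath r (p @ [(f v, v)]) v"
        using p(1) walk' by (simp add: Q.apath_def verts)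
      moreover have "\<forall>x\<in>set (pawalk_verts r (p @ [(f v, v)])). d x \<le> d v"
        using p(2) fv unfolding verts by fastforce
      ultimately show ?thesis by blast
    qed
  qed
  have conn: "Digraph_Component.connected (with_proj t)"
    unfolding Digraph_Component.connected_def Q_def[symmetric]
  proof (rule strongly_connectedI)
    show "verts (with_proj Q) \<noteq> {}" using rV vertsQ by auto
    have reach: "r \<rightarrow>\<^sup>*\<^bsub>with_proj Q\<^esub> v" if "v \<in> V" for v
      using path[OF that] by (auto simp: Q.apath_def intro: Q.reachable_awalkI)
    fix u v assume "u \<in> verts (with_proj Q)" "v \<in> verts (with_proj Q)"
    then have "r \<rightarrow>\<^sup>*\<^bsub>with_proj Q\<^esub> u" "r \<rightarrow>\<^sup>*\<^bsub>with_proj Q\<^esub> v" using reach vertsQ by simp_all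
    then show "u \<rightarrow>\<^sup>*\<^bsub>with_proj Q\<^esub> v"
      using symmetric_reachable[OF Q.pair_sym_arcs] Q.reachable_trans by blast
  qed
  have acyclic: "\<not> (Q.cycle p \<and> 3 \<le> length p)" for p
  proof
    assume "Q.cycle p \<and> 3 \<le> length p"
    then obtain u where walk: "Q.awalk u p u" and dist: "distinct (tl (pawalk_verts u p))"
      and len: "3 \<le> length p" by (auto simp: Q.cycle_def)
    define n where "n = length p"
    define h where "h i = snd (p ! i)" for i
    have cas: "pcas u p u" and sub: "set p \<subseteq> parcs Q" using walk by (auto simp: Q.awalk_def)
    have first: "fst (p ! 0) = u" using cas len by (cases p) auto
    have "p \<noteq> []" using len by auto
    then have final: "h (n - 1) = u"
      using pcas_last[OF cas] by (simp add: h_def n_def last_conv_nth)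
    have consec: "fst (p ! Suc i) = h i" if "Suc i < n" for i
      using pcas_consecutive[OF cas] that by (simp add: h_def n_def)
    have "distinct (map snd p)"
      using dist Q.awalk_verts_conv'[of u p u] cas len by (cases p) auto
    then have inj: "h i \<noteq> h j" if "i < n" "j < n" "i \<noteq> j" for i j
      using that nth_eq_iff_index_eq[of "map snd p" i j] by (simp add: h_def n_def)
    have n3: "3 \<le> n" using len by (simp add: n_def)
    let ?D = "(\<lambda>i. d (h i)) ` {..<n}"
    have "finite ?D" "?D \<noteq> {}" using n3 by (simp_all add: lessThan_empty_iff)
    from Max_in[OF this] obtain m where m_max: "m < n" "Max ?D = d (h m)" by auto
    have m: "m < n" "\<And>i. i < n \<Longrightarrow> d (h i) \<le> d (h m)"
      using m_max Max_ge[OF \<open>finite ?D\<close>] by simp_all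
    \<comment> \<open>The neighbours of the top vertex \<open>h m\<close> on the cycle, in cyclic order.\<close>
    define before where "before = (if m = 0 then n - 1 else m - 1)"
    define after where "after = (if m = n - 1 then 0 else Suc m)"
    have arc: "(h (if i = 0 then n - 1 else i - 1), h i) \<in> parcs Q" if "i < n" for i
    proof -
      have "fst (p ! i) = h (if i = 0 then n - 1 else i - 1)"
        using first final consec[of "i - 1"] that by auto
      moreover have "p ! i \<in> parcs Q" using sub that by (auto simp: n_def)
      ultimately show ?thesis unfolding h_def by (metis prod.collapse)
    qed
    have top: "x = f (h m)" if "(x, h m) \<in> parcs Q" "d x \<le> d (h m)" for x
      using that f[of x] by (auto simp: arcsQ)
    have neighbours: "before < n" "after < n" "before \<noteq> after"
      using m(1) n3 by (auto simp: before_def after_def)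
    have "(h before, h m) \<in> parcs Q" using arc[OF m(1)] by (simp add: before_def)
    then have 1: "h before = f (h m)" by (rule top) (rule m(2)[OF neighbours(1)])
    have "(h after, h m) \<in> parcs Q"
    proof (rule Q.arcs_symmetric)
      show "(h m, h after) \<in> parcs Q"
        using arc[of after] m(1) n3 by (auto simp: after_def split: if_splits)
    qed
    then have 2: "h after = f (h m)" by (rule top) (rule m(2)[OF neighbours(2)])
    show False using inj[OF neighbours] 1 2 by simp
  qed
  have "out_tree r (with_proj t)"
    unfolding out_tree_def underlying_tree_def Q_def[symmetric]
  proof (intro conjI conn ballI)
    show "\<not> (\<exists>p. Q.cycle p \<and> 3 \<le> length p)" using acyclic by blast
    show "r \<in> verts (with_proj t)" using rV by (simp add: t_def)
    fix e assume "e \<in> arcs (with_proj t)"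
    then obtain v where e: "e = (f v, v)" "v \<in> V" "v \<noteq> r" by (auto simp: t_def)
    then show "\<exists>p. Q.apath r (p @ [(tail (with_proj t) e, head (with_proj t) e)]) (head (with_proj t) e)"
      using path[of v] by auto
  qed
  moreover have "pverts t = {v. (r, v) \<in> (parcs G)\<^sup>*}" "parcs t \<subseteq> parcs G"
    using f by (auto simp: t_def V_def)
  ultimately show ?thesis using t.pair_wf_digraph_axioms by blast
qed

lemma subgraph_with_proj:
  assumes "subgraph T (with_proj G)"
  obtains t where "T = with_proj t" "pair_wf_digraph t" "pverts t \<subseteq> pverts G" "parcs t \<subseteq> parcs G"
proof
  let ?t = "\<lparr>pverts = verts T, parcs = arcs T\<rparr>"
  show T: "T = with_proj ?t"
    using assms by (auto simp: subgraph_def compatible_def with_proj_def intro!: pre_digraph.equality)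
  show "pair_wf_digraph ?t" using assms T wf_digraph_wp_iff by (metis subgraph_def)
  show "pverts ?t \<subseteq> pverts G" "parcs ?t \<subseteq> parcs G" using assms by (auto simp: subgraph_def)
qed

lemma with_proj_subgraph:
  assumes "pair_wf_digraph t" "pair_wf_digraph G" "pverts t \<subseteq> pverts G" "parcs t \<subseteq> parcs G"
  shows "subgraph (with_proj t) (with_proj G)"
  using assms by (intro subgraphI) (auto simp: wf_digraph_wp_iff)

lemma infinite_out_component_iff:
  assumes G: "pair_wf_digraph G"
  shows "(\<exists>H. out_component H (with_proj G) \<and> infinite (verts H)) \<longleftrightarrow>
    (\<exists>r\<in>pverts G. infinite {v. (r, v) \<in> (parcs G)\<^sup>*})"
proof
  assume "\<exists>H. out_component H (with_proj G) \<and> infinite (verts H)"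
  then obtain H T r where H: "subgraph H (with_proj G)" "infinite (verts H)"
    and T: "spanning T H" "out_tree r T" by (auto simp: out_component_def)
  from T(1) H(1) have "subgraph T (with_proj G)" by (auto simp: spanning_def intro: subgraph_trans)
  then obtain t where t: "T = with_proj t" "pair_wf_digraph t" "pverts t \<subseteq> pverts G" "parcs t \<subseteq> parcs G"
    by (rule subgraph_with_proj)
  have "infinite (pverts t)" using H(2) T(1) t(1) by (simp add: spanning_def)
  moreover have "pverts t \<subseteq> {v. (r, v) \<in> (parcs G)\<^sup>*}"
    using out_tree_reachable[OF t(2) T(2)[unfolded t(1)]] rtrancl_mono[OF t(4)] by blast
  moreover have "r \<in> pverts G" using T(2) t by (auto simp: out_tree_def)
  ultimately show "\<exists>r\<in>pverts G. infinite {v. (r, v) \<in> (parcs G)\<^sup>*}" using finite_subset by blast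
next
  assume "\<exists>r\<in>pverts G. infinite {v. (r, v) \<in> (parcs G)\<^sup>*}"
  then obtain r where r: "r \<in> pverts G" "infinite {v. (r, v) \<in> (parcs G)\<^sup>*}" by blast
  then obtain t where t: "pair_wf_digraph t" "pverts t = {v. (r, v) \<in> (parcs G)\<^sup>*}" "parcs t \<subseteq> parcs G"
    "out_tree r (with_proj t)"
    using breadth_first_out_tree[OF G] by blast
  have "v \<in> pverts G" if "(r, v) \<in> (parcs G)\<^sup>*" for v
    using that r(1) G by induction (auto simp: pair_wf_digraph_def)
  then have sub: "subgraph (with_proj t) (with_proj G)"
    using t by (intro with_proj_subgraph G) auto
  have "spanning (with_proj t) (with_proj t)"
    using t(1) by (auto simp: spanning_def intro!: with_proj_subgraph)
  with sub t have "out_component (with_proj t) (with_proj G)" by (auto simp: out_component_def)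
  then show "\<exists>H. out_component H (with_proj G) \<and> infinite (verts H)" using t(2) r(2) by (intro exI[of _ "with_proj t"]) simp
qed

lemma infinite_in_component_iff:
  assumes G: "pair_wf_digraph G"
  shows "(\<exists>H. in_component H (with_proj G) \<and> infinite (verts H)) \<longleftrightarrow>
    (\<exists>r\<in>pverts G. infinite {v. (v, r) \<in> (parcs G)\<^sup>*})"
proof -
  have "(\<exists>H. in_component H (with_proj G) \<and> infinite (verts H)) \<longleftrightarrow>
      (\<exists>H. out_component H (with_proj (reverse_arcs G)) \<and> infinite (verts H))"
  proof
    assume "\<exists>H. in_component H (with_proj G) \<and> infinite (verts H)"
    then obtain H T r where H: "subgraph H (with_proj G)" "infinite (verts H)"
      and T: "spanning T H" "in_tree r T" by (auto simp: in_component_def)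
    from T(1) H(1) have "subgraph T (with_proj G)" by (auto simp: spanning_def intro: subgraph_trans)
    then obtain t where t: "T = with_proj t" "pair_wf_digraph t" "pverts t \<subseteq> pverts G" "parcs t \<subseteq> parcs G"
      by (rule subgraph_with_proj)
    have "out_tree r (with_proj (reverse_arcs t))"
      using T(2) in_tree_iff_out_tree_reverse[OF t(2)] by (simp add: t(1))
    moreover have "subgraph (with_proj (reverse_arcs t)) (with_proj (reverse_arcs G))"
      using t G by (intro with_proj_subgraph pair_wf_digraph_reverse_arcs) auto
    moreover have "spanning (with_proj (reverse_arcs t)) (with_proj (reverse_arcs t))"
      using t(2) by (auto simp: spanning_def intro!: with_proj_subgraph pair_wf_digraph_reverse_arcs)
    ultimately have "out_component (with_proj (reverse_arcs t)) (with_proj (reverse_arcs G))"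
      by (auto simp: out_component_def)
    moreover have "infinite (verts (with_proj (reverse_arcs t)))"
      using H(2) T(1) t(1) by (simp add: spanning_def)
    ultimately show "\<exists>H. out_component H (with_proj (reverse_arcs G)) \<and> infinite (verts H)" by blast
  next
    assume "\<exists>H. out_component H (with_proj (reverse_arcs G)) \<and> infinite (verts H)"
    then obtain H T r where H: "subgraph H (with_proj (reverse_arcs G))" "infinite (verts H)"
      and T: "spanning T H" "out_tree r T" by (auto simp: out_component_def)
    from T(1) H(1) have "subgraph T (with_proj (reverse_arcs G))" by (auto simp: spanning_def intro: subgraph_trans)
    then obtain t where t: "T = with_proj t" "pair_wf_digraph t" "pverts t \<subseteq> pverts (reverse_arcs G)"
      "parcs t \<subseteq> parcs (reverse_arcs G)"
      by (rule subgraph_with_proj)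
    have "in_tree r (with_proj (reverse_arcs t))"
      using T(2) in_tree_iff_out_tree_reverse[OF pair_wf_digraph_reverse_arcs[OF t(2)]] by (simp add: t(1))
    moreover have "subgraph (with_proj (reverse_arcs t)) (with_proj G)"
      using t G by (intro with_proj_subgraph pair_wf_digraph_reverse_arcs) auto
    moreover have "spanning (with_proj (reverse_arcs t)) (with_proj (reverse_arcs t))"
      using t(2) by (auto simp: spanning_def intro!: with_proj_subgraph pair_wf_digraph_reverse_arcs)
    ultimately have "in_component (with_proj (reverse_arcs t)) (with_proj G)"
      by (auto simp: in_component_def)
    moreover have "infinite (verts (with_proj (reverse_arcs t)))"
      using H(2) T(1) t(1) by (simp add: spanning_def)
    ultimately show "\<exists>H. in_component H (with_proj G) \<and> infinite (verts H)" by blast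
  qed
  also have "\<dots> \<longleftrightarrow> (\<exists>r\<in>pverts G. infinite {v. (r, v) \<in> ((parcs G)\<inverse>)\<^sup>*})"
    using infinite_out_component_iff[OF pair_wf_digraph_reverse_arcs[OF G]] by simp
  finally show ?thesis by (simp add: rtrancl_converse)
qed

section \<open>Measurability of reachability\<close>

text \<open>A label \<open>(n, c)\<close> names the dyadic cell \<open>c\<close> of mesh \<open>1 / 2 ^ n\<close>. It denotes a point of
\<open>S\<close> if this is the only point of \<open>S\<close> in the cell.\<close>

abbreviation label_cell :: "nat \<times> int \<times> int \<Rightarrow> (real ^ 2) set" where
  "label_cell a \<equiv> grid_cell (1 / 2 ^ fst a) (snd a)"

definition lone :: "(real ^ 2) set \<Rightarrow> nat \<times> int \<times> int \<Rightarrow> bool" where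
  "lone S a \<longleftrightarrow> card (S \<inter> label_cell a) = 1"

definition position :: "(real ^ 2) set \<Rightarrow> nat \<times> int \<times> int \<Rightarrow> real ^ 2" where
  "position S a = (if lone S a then the_elem (S \<inter> label_cell a) else 0)"

lemma lone_position:
  assumes "lone S a"
  shows "S \<inter> label_cell a = {position S a}"
proof -
  obtain x where "S \<inter> label_cell a = {x}" using assms unfolding lone_def by (rule card_1_singletonE)
  then show ?thesis using assms by (simp add: position_def)
qed

lemma position_in: "lone S a \<Longrightarrow> position S a \<in> S"
  using lone_position by blast

lemma grid_cell_diameter:
  assumes "0 < h" "x \<in> grid_cell h c" "y \<in> grid_cell h c"
  shows "dist x y \<le> 2 * h"
proof -
  have "\<bar>x $ 1 - y $ 1\<bar> \<le> h" "\<bar>x $ 2 - y $ 2\<bar> \<le> h"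
    using assms(2,3) unfolding grid_cell_iff[OF assms(1)] by (simp_all add: abs_le_iff algebra_simps)
  moreover have "dist x y \<le> \<bar>x $ 1 - y $ 1\<bar> + \<bar>x $ 2 - y $ 2\<bar>"
    using norm_le_l1_cart[of "x - y"] by (simp add: dist_norm sum_2)
  ultimately show ?thesis by linarith
qed

text \<open>A point of a locally finite set is isolated, so a sufficiently small cell separates it
from all others.\<close>

lemma exists_label:
  assumes S: "S \<in> locally_finite_sets" and x: "x \<in> S"
  shows "\<exists>a. lone S a \<and> position S a = x"
proof -
  have fin: "finite (S \<inter> ball x 1 - {x})" using S by (auto simp: locally_finite_sets_def)
  then obtain d where d: "0 < d" "\<And>y. y \<in> S \<inter> ball x 1 - {x} \<Longrightarrow> d \<le> dist x y"
    using finite_set_avoid[OF fin, of x] by auto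
  obtain n where n: "(1 / 2) ^ n < min d 1 / 2" using real_arch_pow_inv[of "min d 1 / 2" "1 / 2"] d(1) by auto
  define a where "a = (n, grid_index (1 / 2 ^ n) x)"
  have xa: "x \<in> label_cell a" by (simp add: a_def grid_cell_def)
  have "y = x" if "y \<in> S" "y \<in> label_cell a" for y
  proof (rule ccontr)
    assume "y \<noteq> x"
    have "dist x y \<le> 2 * (1 / 2 ^ n)"
      using grid_cell_diameter[OF _ xa that(2)] by (simp add: a_def)
    also have "\<dots> < min d 1" using n by (simp add: power_one_over)
    finally show False using d(2)[of y] that(1) \<open>y \<noteq> x\<close> by auto
  qed
  then have *: "S \<inter> label_cell a = {x}" using x xa by blast
  then have "lone S a" by (simp add: lone_def)
  moreover have "position S a = x" using lone_position[OF calculation] * by simp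
  ultimately show ?thesis by blast
qed

lemma lone_measurable:
  assumes "poisson_process M c N"
  shows "Measurable.pred M (\<lambda>\<omega>. lone (N \<omega>) a)"
proof -
  have [measurable]: "(\<lambda>\<omega>. card (N \<omega> \<inter> label_cell a)) \<in> measurable M (count_space UNIV)"
    by (intro count_measurable[OF assms] grid_cell_borel grid_cell_bounded) simp
  show ?thesis unfolding lone_def by measurable
qed

text \<open>For a label of a point, this point lies in \<open>B\<close> if and only if the count in the
intersection of the cell with \<open>B\<close> is still 1.\<close>

lemma position_measurable:
  assumes N: "poisson_process M c N"
  shows "(\<lambda>\<omega>. position (N \<omega>) a) \<in> borel_measurable M"
proof (rule measurableI)
  fix B :: "(real ^ 2) set" assume B: "B \<in> sets borel"
  have bd: "bounded (label_cell a \<inter> B)"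
    by (rule bounded_Int) (simp add: grid_cell_bounded)
  have [measurable]: "(\<lambda>\<omega>. card (N \<omega> \<inter> (label_cell a \<inter> B))) \<in> measurable M (count_space UNIV)"
    using B by (intro count_measurable[OF N] bd sets.Int grid_cell_borel)
  have [measurable]: "Measurable.pred M (\<lambda>\<omega>. lone (N \<omega>) a)" by (rule lone_measurable[OF N])
  have "position (N \<omega>) a \<in> B \<longleftrightarrow>
      (lone (N \<omega>) a \<and> card (N \<omega> \<inter> (label_cell a \<inter> B)) = 1 \<or> \<not> lone (N \<omega>) a \<and> 0 \<in> B)" for \<omega>
  proof (cases "lone (N \<omega>) a")
    case True
    have "N \<omega> \<inter> (label_cell a \<inter> B) = {position (N \<omega>) a} \<inter> B" using lone_position[OF True] by blast
    then show ?thesis using True by (cases "position (N \<omega>) a \<in> B") auto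
  qed (simp add: position_def)
  then have "(\<lambda>\<omega>. position (N \<omega>) a) -` B \<inter> space M = {\<omega> \<in> space M.
      lone (N \<omega>) a \<and> card (N \<omega> \<inter> (label_cell a \<inter> B)) = 1 \<or> \<not> lone (N \<omega>) a \<and> 0 \<in> B}" by auto
  also have "\<dots> \<in> sets M" by measurable
  finally show "(\<lambda>\<omega>. position (N \<omega>) a) -` B \<inter> space M \<in> sets M" .
qed auto

text \<open>A random relation between points is measurable if it is so when read through labels. As
there are countably many labels, this notion is stable under composition and hence under
reachability.\<close>

definition measurable_relation ::
    "'w measure \<Rightarrow> ('w \<Rightarrow> (real ^ 2) set) \<Rightarrow> ('w \<Rightarrow> (real ^ 2) rel) \<Rightarrow> bool" where
  "measurable_relation M N R \<longleftrightarrow> (\<forall>a b. Measurable.pred M (\<lambda>\<omega>.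
     lone (N \<omega>) a \<and> lone (N \<omega>) b \<and> (position (N \<omega>) a, position (N \<omega>) b) \<in> R \<omega>))"

lemma measurable_relationD:
  assumes "measurable_relation M N R"
  shows "Measurable.pred M (\<lambda>\<omega>.
    lone (N \<omega>) a \<and> lone (N \<omega>) b \<and> (position (N \<omega>) a, position (N \<omega>) b) \<in> R \<omega>)"
  using assms[unfolded measurable_relation_def, rule_format] .

lemma measurable_relation_secrecy:
  assumes N: "poisson_process M c P" and N': "poisson_process M c' P'"
  shows "measurable_relation M P (\<lambda>\<omega>. parcs (secrecy_digraph (P \<omega>) (P' \<omega>)))"
  unfolding measurable_relation_def
proof (intro allI)
  fix a b
  have [measurable]: "Measurable.pred M (\<lambda>\<omega>. lone (P \<omega>) a)" "Measurable.pred M (\<lambda>\<omega>. lone (P' \<omega>) a)"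
    "(\<lambda>\<omega>. position (P \<omega>) a) \<in> borel_measurable M" "(\<lambda>\<omega>. position (P' \<omega>) a) \<in> borel_measurable M" for a
    by (intro lone_measurable[OF N] lone_measurable[OF N'] position_measurable[OF N] position_measurable[OF N'])+
  have "Measurable.pred M (\<lambda>\<omega>. lone (P \<omega>) a \<and> lone (P \<omega>) b \<and> position (P \<omega>) a \<noteq> position (P \<omega>) b \<and>
      (\<forall>d. lone (P' \<omega>) d \<longrightarrow> dist (position (P \<omega>) a) (position (P \<omega>) b) \<le> dist (position (P \<omega>) a) (position (P' \<omega>) d)))"
    by measurable
  moreover have "(lone (P \<omega>) a \<and> lone (P \<omega>) b \<and> position (P \<omega>) a \<noteq> position (P \<omega>) b \<and>
      (\<forall>d. lone (P' \<omega>) d \<longrightarrow> dist (position (P \<omega>) a) (position (P \<omega>) b) \<le> dist (position (P \<omega>) a) (position (P' \<omega>) d))) \<longleftrightarrow>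
      (lone (P \<omega>) a \<and> lone (P \<omega>) b \<and> (position (P \<omega>) a, position (P \<omega>) b) \<in> parcs (secrecy_digraph (P \<omega>) (P' \<omega>)))"
    if "\<omega> \<in> space M" for \<omega>
  proof -
    have "P' \<omega> \<inter> ball x r = {} \<longleftrightarrow> (\<forall>d. lone (P' \<omega>) d \<longrightarrow> r \<le> dist x (position (P' \<omega>) d))" for x r
      using exists_label[OF configurations_locally_finite[OF N' that]] position_in[of "P' \<omega>"]
      by (auto simp: disjoint_iff not_less) metis
    then show ?thesis
      using position_in[of "P \<omega>" a] position_in[of "P \<omega>" b] by (auto simp: secrecy_digraph_def)
  qed
  ultimately show "Measurable.pred M (\<lambda>\<omega>. lone (P \<omega>) a \<and> lone (P \<omega>) b \<and>
      (position (P \<omega>) a, position (P \<omega>) b) \<in> parcs (secrecy_digraph (P \<omega>) (P' \<omega>)))"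
    by (rule measurable_cong[THEN iffD1, rotated])
qed

lemma measurable_relation_converse:
  assumes "measurable_relation M N R"
  shows "measurable_relation M N (\<lambda>\<omega>. (R \<omega>)\<inverse>)"
  unfolding measurable_relation_def
proof (intro allI)
  fix a b
  have "Measurable.pred M (\<lambda>\<omega>. lone (N \<omega>) b \<and> lone (N \<omega>) a \<and> (position (N \<omega>) b, position (N \<omega>) a) \<in> R \<omega>)"
    by (rule measurable_relationD[OF assms])
  then show "Measurable.pred M (\<lambda>\<omega>. lone (N \<omega>) a \<and> lone (N \<omega>) b \<and> (position (N \<omega>) a, position (N \<omega>) b) \<in> (R \<omega>)\<inverse>)"
    by (simp add: conj_ac)
qed

lemma measurable_relation_Un_Int:
  assumes "measurable_relation M N R" "measurable_relation M N R'"
  shows "measurable_relation M N (\<lambda>\<omega>. R \<omega> \<union> R' \<omega>)" "measurable_relation M N (\<lambda>\<omega>. R \<omega> \<inter> R' \<omega>)"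
proof -
  let ?p = "\<lambda>R a b \<omega>. lone (N \<omega>) a \<and> lone (N \<omega>) b \<and> (position (N \<omega>) a, position (N \<omega>) b) \<in> R \<omega>"
  have [measurable]: "Measurable.pred M (?p R a b)" "Measurable.pred M (?p R' a b)" for a b
    by (intro measurable_relationD assms)+
  have "?p (\<lambda>\<omega>. R \<omega> \<union> R' \<omega>) a b = (\<lambda>\<omega>. ?p R a b \<omega> \<or> ?p R' a b \<omega>)"
    "?p (\<lambda>\<omega>. R \<omega> \<inter> R' \<omega>) a b = (\<lambda>\<omega>. ?p R a b \<omega> \<and> ?p R' a b \<omega>)" for a b by auto
  moreover have "Measurable.pred M (\<lambda>\<omega>. ?p R a b \<omega> \<or> ?p R' a b \<omega>)" "Measurable.pred M (\<lambda>\<omega>. ?p R a b \<omega> \<and> ?p R' a b \<omega>)" for a b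
    by measurable
  ultimately show "measurable_relation M N (\<lambda>\<omega>. R \<omega> \<union> R' \<omega>)" "measurable_relation M N (\<lambda>\<omega>. R \<omega> \<inter> R' \<omega>)"
    unfolding measurable_relation_def by simp_all
qed

lemma measurable_relation_rtrancl:
  assumes N: "poisson_process M c N" and R: "measurable_relation M N R"
    and sub: "\<And>\<omega>. \<omega> \<in> space M \<Longrightarrow> R \<omega> \<subseteq> N \<omega> \<times> N \<omega>"
  shows "measurable_relation M N (\<lambda>\<omega>. (R \<omega>)\<^sup>*)"
proof -
  let ?p = "\<lambda>R a b \<omega>. lone (N \<omega>) a \<and> lone (N \<omega>) b \<and> (position (N \<omega>) a, position (N \<omega>) b) \<in> R \<omega>"
  have [measurable]: "Measurable.pred M (\<lambda>\<omega>. lone (N \<omega>) a)" "(\<lambda>\<omega>. position (N \<omega>) a) \<in> borel_measurable M" for a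
    by (intro lone_measurable[OF N] position_measurable[OF N])+
  have [measurable]: "Measurable.pred M (?p R a b)" for a b by (rule measurable_relationD[OF R])
  have pow [measurable]: "Measurable.pred M (?p (\<lambda>\<omega>. R \<omega> ^^ n) a b)" for n a b
  proof (induction n arbitrary: b)
    case 0
    show ?case by simp
  next
    case (Suc n)
    note Suc.IH[measurable]
    have "Measurable.pred M (\<lambda>\<omega>. \<exists>d. ?p (\<lambda>\<omega>. R \<omega> ^^ n) a d \<omega> \<and> ?p R d b \<omega>)" by measurable
    moreover have "(\<exists>d. ?p (\<lambda>\<omega>. R \<omega> ^^ n) a d \<omega> \<and> ?p R d b \<omega>) \<longleftrightarrow> ?p (\<lambda>\<omega>. R \<omega> ^^ Suc n) a b \<omega>"
      if \<omega>: "\<omega> \<in> space M" for \<omega>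
    proof
      assume "?p (\<lambda>\<omega>. R \<omega> ^^ Suc n) a b \<omega>"
      then obtain y where y: "(position (N \<omega>) a, y) \<in> R \<omega> ^^ n" "(y, position (N \<omega>) b) \<in> R \<omega>"
        and ab: "lone (N \<omega>) a" "lone (N \<omega>) b" by auto
      have "y \<in> N \<omega>" using y(2) sub[OF \<omega>] by auto
      then obtain d where "lone (N \<omega>) d" "position (N \<omega>) d = y"
        using exists_label[OF configurations_locally_finite[OF N \<omega>]] by blast
      with y ab show "\<exists>d. ?p (\<lambda>\<omega>. R \<omega> ^^ n) a d \<omega> \<and> ?p R d b \<omega>" by blast
    qed auto
    ultimately show ?case by (rule measurable_cong[THEN iffD1, rotated])
  qed
  have "?p (\<lambda>\<omega>. (R \<omega>)\<^sup>*) a b = (\<lambda>\<omega>. \<exists>n. ?p (\<lambda>\<omega>. R \<omega> ^^ n) a b \<omega>)" for a b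
    by (auto simp: rtrancl_power)
  moreover have "Measurable.pred M (\<lambda>\<omega>. \<exists>n. ?p (\<lambda>\<omega>. R \<omega> ^^ n) a b \<omega>)" for a b by measurable
  ultimately show ?thesis unfolding measurable_relation_def by simp
qed

lemma infinite_iff_unbounded:
  assumes "S \<in> locally_finite_sets" "Y \<subseteq> S"
  shows "infinite Y \<longleftrightarrow> (\<forall>k::nat. \<exists>y\<in>Y. real k < norm y)"
proof
  assume inf: "infinite Y"
  show "\<forall>k::nat. \<exists>y\<in>Y. real k < norm y"
  proof (rule allI, rule ccontr)
    fix k :: nat
    assume "\<not> (\<exists>y\<in>Y. real k < norm y)"
    then have "Y \<subseteq> S \<inter> cball 0 (real k)" using assms(2) by (auto simp: not_less)
    moreover have "finite (S \<inter> cball 0 (real k))" using assms(1) by (auto simp: locally_finite_sets_def)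
    ultimately show False using inf finite_subset by blast
  qed
next
  assume far: "\<forall>k::nat. \<exists>y\<in>Y. real k < norm y"
  show "infinite Y"
  proof
    assume "finite Y"
    then obtain B where "\<And>y. y \<in> Y \<Longrightarrow> norm y \<le> B" using finite_imp_bounded bounded_iff by metis
    moreover obtain k :: nat where "B < real k" using reals_Archimedean2 by blast
    ultimately show False using far by (meson less_le_not_le order.strict_trans2 order_less_trans)
  qed
qed

text \<open>A subset of a locally finite set is infinite if and only if it is unbounded, which is a
countable condition on labels.\<close>

lemma infinite_class_measurable:
  assumes N: "poisson_process M c N" and R: "measurable_relation M N R"
    and sub: "\<And>\<omega> x y. \<omega> \<in> space M \<Longrightarrow> x \<in> N \<omega> \<Longrightarrow> (x, y) \<in> R \<omega> \<Longrightarrow> y \<in> N \<omega>"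
  shows "{\<omega> \<in> space M. \<exists>x\<in>N \<omega>. infinite {y. (x, y) \<in> R \<omega>}} \<in> sets M"
proof -
  let ?p = "\<lambda>a b \<omega>. lone (N \<omega>) a \<and> lone (N \<omega>) b \<and> (position (N \<omega>) a, position (N \<omega>) b) \<in> R \<omega>"
  have [measurable]: "Measurable.pred M (\<lambda>\<omega>. lone (N \<omega>) a)" "(\<lambda>\<omega>. position (N \<omega>) a) \<in> borel_measurable M" for a
    by (intro lone_measurable[OF N] position_measurable[OF N])+
  have [measurable]: "Measurable.pred M (?p a b)" for a b by (rule measurable_relationD[OF R])
  have "(\<exists>x\<in>N \<omega>. infinite {y. (x, y) \<in> R \<omega>}) \<longleftrightarrow>
      (\<exists>a. \<forall>k::nat. \<exists>b. ?p a b \<omega> \<and> real k < norm (position (N \<omega>) b))" if \<omega>: "\<omega> \<in> space M" for \<omega>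
  proof -
    note lf = configurations_locally_finite[OF N \<omega>]
    have inf: "infinite {y. (x, y) \<in> R \<omega>} \<longleftrightarrow> (\<forall>k::nat. \<exists>y. (x, y) \<in> R \<omega> \<and> real k < norm y)" if "x \<in> N \<omega>" for x
      using infinite_iff_unbounded[OF lf, of "{y. (x, y) \<in> R \<omega>}"] sub[OF \<omega> that] by auto
    show ?thesis
    proof
      assume "\<exists>x\<in>N \<omega>. infinite {y. (x, y) \<in> R \<omega>}"
      then obtain x where x: "x \<in> N \<omega>" "\<forall>k::nat. \<exists>y. (x, y) \<in> R \<omega> \<and> real k < norm y" using inf by blast
      obtain a where a: "lone (N \<omega>) a" "position (N \<omega>) a = x" using exists_label[OF lf x(1)] by blast
      have "\<exists>b. ?p a b \<omega> \<and> real k < norm (position (N \<omega>) b)" for k :: nat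
      proof -
        obtain y where y: "(x, y) \<in> R \<omega>" "real k < norm y" using x(2) by blast
        then obtain b where "lone (N \<omega>) b" "position (N \<omega>) b = y"
          using exists_label[OF lf sub[OF \<omega> x(1)]] by blast
        with a y show ?thesis by blast
      qed
      then show "\<exists>a. \<forall>k::nat. \<exists>b. ?p a b \<omega> \<and> real k < norm (position (N \<omega>) b)" by blast
    next
      assume "\<exists>a. \<forall>k::nat. \<exists>b. ?p a b \<omega> \<and> real k < norm (position (N \<omega>) b)"
      then obtain a where a: "\<forall>k::nat. \<exists>b. ?p a b \<omega> \<and> real k < norm (position (N \<omega>) b)" by blast
      then have "position (N \<omega>) a \<in> N \<omega>" using position_in by blast
      moreover have "\<forall>k::nat. \<exists>y. (position (N \<omega>) a, y) \<in> R \<omega> \<and> real k < norm y" using a by blast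
      ultimately show "\<exists>x\<in>N \<omega>. infinite {y. (x, y) \<in> R \<omega>}" using inf by blast
    qed
  qed
  then have "{\<omega> \<in> space M. \<exists>x\<in>N \<omega>. infinite {y. (x, y) \<in> R \<omega>}} =
      {\<omega> \<in> space M. \<exists>a. \<forall>k::nat. \<exists>b. ?p a b \<omega> \<and> real k < norm (position (N \<omega>) b)}" by blast
  also have "\<dots> \<in> sets M" by measurable
  finally show ?thesis .
qed

section \<open>The critical intensities\<close>

lemma secrecy_arcs_subset: "parcs (secrecy_digraph P P') \<subseteq> P \<times> P"
  by (auto simp: secrecy_digraph_def)

lemma pair_wf_secrecy_digraph: "pair_wf_digraph (secrecy_digraph P P')"
  by unfold_locales (auto simp: secrecy_digraph_def)

lemma pair_wf_bidirectional: "pair_wf_digraph (bidirectional_secrecy_graph P P')"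
  by unfold_locales (auto simp: bidirectional_secrecy_graph_def secrecy_digraph_def)

lemma pair_wf_secrecy_graph: "pair_wf_digraph (secrecy_graph P P')"
  unfolding secrecy_graph_def
  by (rule wf_digraph.wellformed_mk_symmetric) (simp add: wf_digraph_wp_iff pair_wf_secrecy_digraph)

lemma pverts_secrecy [simp]:
  "pverts (secrecy_digraph P P') = P" "pverts (secrecy_graph P P') = P"
  "pverts (bidirectional_secrecy_graph P P') = P"
  by (simp_all add: secrecy_digraph_def secrecy_graph_def bidirectional_secrecy_graph_def)

lemma parcs_secrecy_graph:
  "parcs (secrecy_graph P P') = parcs (secrecy_digraph P P') \<union> (parcs (secrecy_digraph P P'))\<inverse>"
  by (auto simp: secrecy_graph_def parcs_mk_symmetric)

lemma parcs_bidirectional: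
  "parcs (bidirectional_secrecy_graph P P') = parcs (secrecy_digraph P P') \<inter> (parcs (secrecy_digraph P P'))\<inverse>"
  by (auto simp: bidirectional_secrecy_graph_def)

lemma event_U_iff: "event_U P P' \<longleftrightarrow> (\<exists>x\<in>P. infinite {y. (x, y) \<in>
    (parcs (secrecy_graph P P'))\<^sup>* \<inter> ((parcs (secrecy_graph P P'))\<^sup>*)\<inverse>})"
  unfolding event_U_def has_infinite_component_iff[OF pair_wf_secrecy_graph] by simp

lemma event_B_iff: "event_B P P' \<longleftrightarrow> (\<exists>x\<in>P. infinite {y. (x, y) \<in>
    (parcs (bidirectional_secrecy_graph P P'))\<^sup>* \<inter> ((parcs (bidirectional_secrecy_graph P P'))\<^sup>*)\<inverse>})"
  unfolding event_B_def has_infinite_component_iff[OF pair_wf_bidirectional] by simp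

lemma event_S_iff: "event_S P P' \<longleftrightarrow> (\<exists>x\<in>P. infinite {y. (x, y) \<in>
    (parcs (secrecy_digraph P P'))\<^sup>* \<inter> ((parcs (secrecy_digraph P P'))\<^sup>*)\<inverse>})"
  unfolding event_S_def infinite_strongly_connected_iff[OF pair_wf_secrecy_digraph] by simp

lemma event_O_iff: "event_O P P' \<longleftrightarrow>
    (\<exists>x\<in>P. infinite {y. (x, y) \<in> (parcs (secrecy_digraph P P'))\<^sup>*})"
  unfolding event_O_def infinite_out_component_iff[OF pair_wf_secrecy_digraph] by simp

lemma event_I_iff: "event_I P P' \<longleftrightarrow>
    (\<exists>x\<in>P. infinite {y. (x, y) \<in> ((parcs (secrecy_digraph P P'))\<^sup>*)\<inverse>})"
  unfolding event_I_def infinite_in_component_iff[OF pair_wf_secrecy_digraph] by simp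

text \<open>Every event that is given by a random relation between mutual reachability and
undirected reachability has positive probability, because it contains the event \<open>A\<close> on which
a mutual cluster is infinite. Measurability is what allows the two probabilities to be
compared.\<close>

lemma percolation_probability_positive:
  fixes P P' :: "real \<Rightarrow> 'w \<Rightarrow> (real ^ 2) set"
  assumes proc: "independent_poisson_processes (M l) 1 (P l) l (P' l)" and l: "0 < l" "l < 0.002"
    and X: "\<And>S S'. X S S' \<longleftrightarrow> (\<exists>x\<in>S. infinite {y. (x, y) \<in> R S S'})"
    and meas: "measurable_relation (M l) (P l) (\<lambda>\<omega>. R (P l \<omega>) (P' l \<omega>))"
    and lower: "\<And>S S'. (parcs (bidirectional_secrecy_graph S S'))\<^sup>* \<subseteq> R S S'"
    and upper: "\<And>S S'. R S S' \<subseteq> (parcs (secrecy_graph S S'))\<^sup>*"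
  shows "percolation_probability M P P' X l \<noteq> 0"
proof -
  have N: "poisson_process (M l) 1 (P l)" using proc by (simp add: independent_poisson_processes_def)
  interpret prob_space "M l" using N by (simp add: poisson_process_def)
  obtain A where A: "A \<in> sets (M l)" "0 < measure (M l) A"
    "\<And>\<omega>. \<omega> \<in> A \<Longrightarrow> \<exists>x\<in>P l \<omega>. infinite {y. (x, y) \<in> (parcs (bidirectional_secrecy_graph (P l \<omega>) (P' l \<omega>)))\<^sup>*}"
    using mutual_cluster_positive[OF proc l] by blast
  have closed: "y \<in> S" if "x \<in> S" "(x, y) \<in> R S S'" for x y S S'
  proof -
    have "(x, y) \<in> (parcs (secrecy_graph S S'))\<^sup>*" using upper that(2) by blast
    then show ?thesis
      using that(1) secrecy_arcs_subset[of S S'] by induction (auto simp: parcs_secrecy_graph)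
  qed
  have "{\<omega> \<in> space (M l). X (P l \<omega>) (P' l \<omega>)} \<in> sets (M l)"
    unfolding X by (rule infinite_class_measurable[OF N meas closed])
  moreover have "A \<subseteq> {\<omega> \<in> space (M l). X (P l \<omega>) (P' l \<omega>)}"
  proof
    fix \<omega> assume \<omega>: "\<omega> \<in> A"
    then obtain x where x: "x \<in> P l \<omega>"
      "infinite {y. (x, y) \<in> (parcs (bidirectional_secrecy_graph (P l \<omega>) (P' l \<omega>)))\<^sup>*}"
      using A(3) by blast
    have "infinite {y. (x, y) \<in> R (P l \<omega>) (P' l \<omega>)}"
      by (rule infinite_super[OF _ x(2)]) (use lower in blast)
    then show "\<omega> \<in> {\<omega> \<in> space (M l). X (P l \<omega>) (P' l \<omega>)}"
      using x(1) sets.sets_into_space[OF A(1)] \<omega> by (auto simp: X)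
  qed
  ultimately have "measure (M l) A \<le> measure (M l) {\<omega> \<in> space (M l). X (P l \<omega>) (P' l \<omega>)}"
    by (intro finite_measure_mono)
  with A(2) show ?thesis by (simp add: percolation_probability_def)
qed

lemma critical_intensity_ge:
  assumes "\<And>l. 0 < l \<Longrightarrow> l < c \<Longrightarrow> percolation_probability M P P' X l \<noteq> 0"
  shows "ereal c \<le> critical_intensity M P P' X"
  unfolding critical_intensity_def
proof (rule Inf_greatest)
  fix z assume "z \<in> {ereal l | l. 0 < l \<and> percolation_probability M P P' X l = 0}"
  then obtain l where "z = ereal l" "0 < l" "percolation_probability M P P' X l = 0" by auto
  with assms[of l] show "ereal c \<le> z" by (cases "l < c") auto
qed

theorem theorem17:
  fixes M :: "real \<Rightarrow> 'w measure"
    and P P' :: "real \<Rightarrow> 'w \<Rightarrow> (real ^ 2) set"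
  assumes "\<And>l. 0 < l \<Longrightarrow> independent_poisson_processes (M l) 1 (P l) l (P' l)"
  shows "critical_intensity M P P' event_U \<ge> ereal 0.002 \<and>
         critical_intensity M P P' event_O \<ge> ereal 0.0008 \<and>
         critical_intensity M P P' event_I \<ge> ereal 0.0008 \<and>
         critical_intensity M P P' event_S \<ge> ereal 0.0008 \<and>
         critical_intensity M P P' event_B \<ge> ereal 0.0005"
proof -
  let ?E = "\<lambda>S S'. parcs (secrecy_digraph S S')"
  let ?U = "\<lambda>S S'. parcs (secrecy_graph S S')"
  let ?B = "\<lambda>S S'. parcs (bidirectional_secrecy_graph S S')"
  have symB: "((?B S S')\<^sup>*)\<inverse> = (?B S S')\<^sup>*" and symU: "((?U S S')\<^sup>*)\<inverse> = (?U S S')\<^sup>*"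
    for S S' :: "(real ^ 2) set"
    by (simp_all add: parcs_bidirectional parcs_secrecy_graph converse_Int converse_Un Int_commute Un_commute
        flip: rtrancl_converse)
  have BE: "(?B S S')\<^sup>* \<subseteq> (?E S S')\<^sup>*" and EU: "(?E S S')\<^sup>* \<subseteq> (?U S S')\<^sup>*" for S S' :: "(real ^ 2) set"
    by (intro rtrancl_mono, simp add: parcs_bidirectional parcs_secrecy_graph)+
  have BE': "(?B S S')\<^sup>* \<subseteq> ((?E S S')\<^sup>*)\<inverse>" and EU': "((?E S S')\<^sup>*)\<inverse> \<subseteq> (?U S S')\<^sup>*"
    for S S' :: "(real ^ 2) set"
    using converse_mono[THEN iffD2, OF BE[of S S']] converse_mono[THEN iffD2, OF EU[of S S']]
    by (simp_all only: symB symU)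
  note BU = subset_trans[OF BE EU]
  have pos: "percolation_probability M P P' event_U l \<noteq> 0 \<and> percolation_probability M P P' event_O l \<noteq> 0 \<and>
      percolation_probability M P P' event_I l \<noteq> 0 \<and> percolation_probability M P P' event_S l \<noteq> 0 \<and>
      percolation_probability M P P' event_B l \<noteq> 0" if l: "0 < l" "l < 0.002" for l
  proof -
    note proc = assms[OF l(1)]
    have N: "poisson_process (M l) 1 (P l)" "poisson_process (M l) l (P' l)"
      using proc by (simp_all add: independent_poisson_processes_def)
    let ?m = "\<lambda>R. measurable_relation (M l) (P l) (\<lambda>\<omega>. R (P l \<omega>) (P' l \<omega>))"
    note conv = measurable_relation_converse and un = measurable_relation_Un_Int(1)
      and int = measurable_relation_Un_Int(2)
    have E: "?m ?E" by (rule measurable_relation_secrecy[OF N])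
    have U: "?m ?U" unfolding parcs_secrecy_graph by (intro un conv E)
    have B: "?m ?B" unfolding parcs_bidirectional by (intro int conv E)
    have sub: "?E S S' \<subseteq> S \<times> S" "?U S S' \<subseteq> S \<times> S" "?B S S' \<subseteq> S \<times> S" for S S' :: "(real ^ 2) set"
      using secrecy_arcs_subset[of S S'] by (auto simp: parcs_secrecy_graph parcs_bidirectional)
    have star: "?m (\<lambda>S S'. (?E S S')\<^sup>*)" "?m (\<lambda>S S'. (?U S S')\<^sup>*)" "?m (\<lambda>S S'. (?B S S')\<^sup>*)"
      by (intro measurable_relation_rtrancl[OF N(1)] E U B sub)+
    note positive = percolation_probability_positive[where M = M and P = P and P' = P' and l = l, OF proc l]
    have "percolation_probability M P P' event_U l \<noteq> 0"
      by (rule positive[OF event_U_iff]; (intro int conv star)?)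
        (simp_all add: symU BU)
    moreover have "percolation_probability M P P' event_O l \<noteq> 0"
      by (rule positive[OF event_O_iff star(1) BE EU])
    moreover have "percolation_probability M P P' event_I l \<noteq> 0"
      by (rule positive[OF event_I_iff conv[OF star(1)] BE' EU'])
    moreover have "percolation_probability M P P' event_S l \<noteq> 0"
      by (rule positive[OF event_S_iff int[OF star(1) conv[OF star(1)]]
            Int_greatest[OF BE BE'] le_infI1[OF EU]])
    moreover have "percolation_probability M P P' event_B l \<noteq> 0"
      by (rule positive[OF event_B_iff]; (intro int conv star)?)
        (simp_all add: symB BU)
    ultimately show ?thesis by blast
  qed
  show ?thesis
    by (intro conjI critical_intensity_ge) (use pos in simp_all)
qed

end
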